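(* Let $w$ be a non-periodic cutting sequence of a linear trajectory in the regular octagon, and let $\{d_k(w)\}_{k\in\mathbb{N}}$ be its sequence of admissible diagrams. Then the direction $\theta\in[0,\pi]$ of the trajectories $\tau$ such that $w=c(\tau)$ is uniquely determined and is given by the octagon additive continued fraction expansion $$\theta=[d_0(w);d_1(w),d_2(w),\ldots,d_k(w),\ldots].$$
   Context: **Octagon and cutting sequences.** Let $O\subset\mathbb{R}^2$ be the regular octagon centred at the origin with unit sides, two of them horizontal, and vertices $O_1,\dots,O_8$ in clockwise order, $\overline{O_1O_2}$ being the top horizontal side. Opposite sides are identified by translation, and the pairs of identified sides are labelled: $\overline{O_1O_2},\overline{O_5O_6}$ by $A$; $\overline{O_2O_3},\overline{O_6O_7}$ by $B$; $\overline{O_3O_4},\overline{O_7O_8}$ by $C$; $\overline{O_4O_5},\overline{O_8O_1}$ by $D$. A (bi-infinite) linear trajectory in direction $\theta$ moves with constant velocity making angle $\theta$ with the horizontal; when it hits a side it re-enters $O$ at the corresponding point of the opposite side with the same velocity; it never hits a vertex and is defined for all times. Its cutting sequence $c(\tau)\in\{A,B,C,D\}^{\mathbb{Z}}$ is the bi-infinite word of labels of sides crossed (considered up to shift). Rotation by $\pi$ preserves labels, hence cutting sequences, so by convention directions are taken in $[0,\pi]$. A word is non-periodic if its letters do not repeat periodically. **Permutations and diagrams.** $\pi_0=\mathrm{Id}$, $\pi_1=(AD)(BC)$, $\pi_2=(ABCD)$, $\pi_3=(AC)$, $\pi_4=(AC)(BD)$, $\pi_5=(AB)(CD)$, $\pi_6=(ADCB)$,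 $\pi_7=(BD)$ (cycle notation: $(ABCD)$ sends $A\mapsto B\mapsto C\mapsto D\mapsto A$), acting on words letter by letter. A word is admissible in diagram $0$ if every pair of consecutive letters belongs to $\{AD,DA,DB,BD,BC,CB,CC\}$; it is admissible in diagram $i$ ($0\le i\le7$) if $\pi_i\cdot w$ is admissible in diagram $0$. **Derivation.** A letter occurrence in a bi-infinite word is sandwiched if the letters immediately before and after it are equal. The derived sequence $w'$ keeps only the sandwiched letters of $w$. **Sequence of admissible diagrams.** For a non-periodic cutting sequence $w$, put $w_0:=w$ and, recursively, let $d_k=d_k(w)\in\{0,\dots,7\}$ be the unique index such that $w_k$ is admissible in diagram $d_k$, and $w_{k+1}:=(\pi_{d_k}\cdot w_k)'$. (It is a fact that for a non-periodic cutting sequence this is well defined for all $k$.) **Continued fraction.** Let $\overline{\Sigma}_i=[i\pi/8,(i+1)\pi/8]$, $i=0,\dots,7$. Let $\nu_i$ be the linear isometry acting on directions by $\theta\mapsto\theta-i\pi/8$ (rotation) if $i$ is even and by $\theta\mapsto(i+1)\pi/8-\theta$ (reflection) if $i$ is odd; it maps $\overline{\Sigma}_i$ onto $\overline\Sigma_0$. Let $\gamma=\begin{pmatrix}-1&2(1+\sqrt2)\\0&1\end{pmatrix}$. For $\theta\in\overline\Sigma_i$ let $F_i(\theta)\in(0,\pi]$ be the angle such that $\gamma\nu_i(\cos\theta,\sin\theta)^{T}$ is parallel to $(\cos F_i(\theta),\sin F_i(\theta))^T$; $F_i$ is a homeomorphism of $\overline\Sigma_i$ onto $[\pi/8,\pi]$.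 Let $S^*$ be the set of sequences $\{s_k\}_{k\in\mathbb{N}}$ with $s_0\in\{0,\dots,7\}$, $s_k\in\{1,\dots,7\}$ for $k\ge1$. For such a sequence, $\overline\Sigma[s_0;s_1,\dots,s_k]:=F_{s_0}^{-1}F_{s_1}^{-1}\cdots F_{s_k}^{-1}[0,\pi]$ (preimages under the maps $F_i:\overline\Sigma_i\to[0,\pi]$). The intersection $\bigcap_k\overline\Sigma[s_0;s_1,\dots,s_k]$ is a single point, and one writes $\theta=[s_0;s_1,s_2,\dots]$ if $\{\theta\}=\bigcap_k\overline\Sigma[s_0;s_1,\dots,s_k]$. *)

theory Defs
  imports "HOL-Analysis.Analysis" "HOL-Combinatorics.Combinatorics"
begin

text \<open>The plane \<open>\<real>\<^sup>2\<close> is identified with the complex plane.\<close>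

subsection \<open>The octagon and its cutting sequences\<close>

text \<open>\<open>oct_vertex k\<close> is periodic in \<open>k\<close> with period 8; the vertices are those with
  \<open>k \<in> {1..8}\<close>, in clockwise order. The circumradius \<open>1 / (2 sin (pi / 8))\<close> gives unit sides.\<close>

definition oct_vertex :: "nat \<Rightarrow> complex" where
  "oct_vertex k = of_real (1 / (2 * sin (pi / 8))) * cis (5 * pi / 8 - (real k - 1) * (pi / 4))"

definition octagon :: "complex set" where
  "octagon = convex hull (oct_vertex ` {1..8})"

text \<open>Sides are taken without their endpoints.\<close>

definition oct_side :: "nat \<Rightarrow> complex set" where
  "oct_side k = open_segment (oct_vertex k) (oct_vertex (k + 1))"

text \<open>The translation carrying side \<open>k\<close> to the opposite side: \<open>oct_vertex k\<close> goes to
  \<open>oct_vertex (k + 5)\<close> and \<open>oct_vertex (k + 1)\<close> goes to \<open>oct_vertex (k + 4)\<close>.\<close>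

definition to_opposite :: "nat \<Rightarrow> complex" where
  "to_opposite k = oct_vertex (k + 5) - oct_vertex k"

datatype letter = A | B | C | D

type_synonym word = "int \<Rightarrow> letter"

definition side_label :: "nat \<Rightarrow> letter" where
  "side_label k = [A, B, C, D] ! ((k - 1) mod 4)"

text \<open>A trajectory is defined for all times. At a time when it hits a side, \<open>\<tau> s\<close> denotes the
  re-entry point (on side \<open>k\<close>), so the point that is hit is \<open>\<tau> s + to_opposite k\<close>, on the opposite
  side. Motion along a side is excluded: for such a motion the two formulas of the second case
  contradict each other at nearby times.\<close>

definition linear_trajectory :: "real \<Rightarrow> (real \<Rightarrow> complex) \<Rightarrow> bool" where
  "linear_trajectory \<theta> \<tau> \<longleftrightarrow> (\<exists>r>0. \<forall>s.
     (\<tau> s \<in> interior octagon \<and>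
        (\<exists>\<epsilon>>0. \<forall>u. \<bar>u\<bar> < \<epsilon> \<longrightarrow> \<tau> (s + u) = \<tau> s + of_real (u * r) * cis \<theta>)) \<or>
     (\<exists>k\<in>{1..8}. \<tau> s \<in> oct_side k \<and>
        (\<exists>\<epsilon>>0. (\<forall>u. 0 \<le> u \<and> u < \<epsilon> \<longrightarrow> \<tau> (s + u) = \<tau> s + of_real (u * r) * cis \<theta>) \<and>
               (\<forall>u. - \<epsilon> < u \<and> u < 0 \<longrightarrow>
                  \<tau> (s + u) = \<tau> s + to_opposite k + of_real (u * r) * cis \<theta>))))"

text \<open>Cutting sequences are considered up to shift, so this is a relation: the increasing
  enumeration \<open>t\<close> of the hitting times by \<open>\<int>\<close> is determined up to a shift only. Opposite sides have
  the same label, so the side of the re-entry point gives the label of the side hit.\<close>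

definition cutting_sequence :: "(real \<Rightarrow> complex) \<Rightarrow> word \<Rightarrow> bool" where
  "cutting_sequence \<tau> w \<longleftrightarrow> (\<exists>t :: int \<Rightarrow> real. strict_mono t \<and>
     range t = {s. \<exists>k\<in>{1..8}. \<tau> s \<in> oct_side k} \<and>
     (\<forall>n. \<exists>k\<in>{1..8}. \<tau> (t n) \<in> oct_side k \<and> w n = side_label k))"

definition periodic_word :: "word \<Rightarrow> bool" where
  "periodic_word w \<longleftrightarrow> (\<exists>p>0. \<forall>n. w (n + p) = w n)"

subsection \<open>Admissible diagrams and derivation\<close>

definition diagram_perm :: "nat \<Rightarrow> letter \<Rightarrow> letter" where
  "diagram_perm i =
     [id,
      cycle_of_list [A, D] \<circ> cycle_of_list [B, C],
      cycle_of_list [A, B, C, D],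
      cycle_of_list [A, C],
      cycle_of_list [A, C] \<circ> cycle_of_list [B, D],
      cycle_of_list [A, B] \<circ> cycle_of_list [C, D],
      cycle_of_list [A, D, C, B],
      cycle_of_list [B, D]] ! i"

definition admissible0 :: "word \<Rightarrow> bool" where
  "admissible0 w \<longleftrightarrow>
     (\<forall>n. (w n, w (n + 1)) \<in> {(A, D), (D, A), (D, B), (B, D), (B, C), (C, B), (C, C)})"

definition admissible :: "nat \<Rightarrow> word \<Rightarrow> bool" where
  "admissible i w \<longleftrightarrow> admissible0 (diagram_perm i \<circ> w)"

definition sandwiched :: "word \<Rightarrow> int set" where
  "sandwiched w = {n. w (n - 1) = w (n + 1)}"

text \<open>The increasing enumeration of the sandwiched occurrences by \<open>\<int>\<close> (when there is one, i.e.
  when they are unbounded in both directions) is determined up to a shift only; the choice of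
  the origin is immaterial.\<close>

definition derived_word :: "word \<Rightarrow> word" where
  "derived_word w = w \<circ> (SOME f :: int \<Rightarrow> int. strict_mono f \<and> range f = sandwiched w)"

definition diagram_of :: "word \<Rightarrow> nat" where
  "diagram_of w = (THE i. i \<le> 7 \<and> admissible i w)"

primrec renorm_word :: "word \<Rightarrow> nat \<Rightarrow> word" where
  "renorm_word w 0 = w"
| "renorm_word w (Suc k) =
     derived_word (diagram_perm (diagram_of (renorm_word w k)) \<circ> renorm_word w k)"

definition diagram_seq :: "word \<Rightarrow> nat \<Rightarrow> nat" where
  "diagram_seq w k = diagram_of (renorm_word w k)"

subsection \<open>The octagon additive continued fraction\<close>

definition sector :: "nat \<Rightarrow> real set" where
  "sector i = {real i * pi / 8 .. (real i + 1) * pi / 8}"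

text \<open>The linear isometry taking \<open>cis \<theta>\<close> to \<open>cis (\<theta> - i * pi / 8)\<close> for even \<open>i\<close> and to
  \<open>cis ((i + 1) * pi / 8 - \<theta>)\<close> for odd \<open>i\<close>.\<close>

definition nu :: "nat \<Rightarrow> complex \<Rightarrow> complex" where
  "nu i z = (if even i then cis (- (real i * pi / 8)) * z
             else cis ((real i + 1) * pi / 8) * cnj z)"

definition gamma_map :: "complex \<Rightarrow> complex" where
  "gamma_map z = Complex (- Re z + 2 * (1 + sqrt 2) * Im z) (Im z)"

definition farey :: "nat \<Rightarrow> real \<Rightarrow> real" where
  "farey i \<theta> = (THE \<phi>. 0 < \<phi> \<and> \<phi> \<le> pi \<and>
     (\<exists>c::real. c \<noteq> 0 \<and> gamma_map (nu i (cis \<theta>)) = of_real c * cis \<phi>))"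

text \<open>\<open>cf_cell [s\<^sub>0, \<dots>, s\<^sub>k]\<close> is the sector of all directions in \<open>[0, pi]\<close> whose expansion can
  start with these entries.\<close>

primrec cf_cell :: "nat list \<Rightarrow> real set" where
  "cf_cell [] = {0..pi}"
| "cf_cell (i # ss) = {\<theta> \<in> sector i. farey i \<theta> \<in> cf_cell ss}"

definition S_star :: "(nat \<Rightarrow> nat) set" where
  "S_star = {s. s 0 \<in> {0..7} \<and> (\<forall>k\<ge>1. s k \<in> {1..7})}"

definition octagon_cf :: "real \<Rightarrow> (nat \<Rightarrow> nat) \<Rightarrow> bool" where
  "octagon_cf \<theta> s \<longleftrightarrow> s \<in> S_star \<and> (\<Inter>k. cf_cell (map s [0..<Suc k])) = {\<theta>}"

end

theory Submission
  imports Defs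
begin

text \<open>
  Write \<open>\<times>\<close> for the planar cross product. Record a crossing by the label \<open>X\<close> of its side and by
  \<open>2 v \<times> o\<close>, where \<open>v\<close> is the direction and \<open>o\<close> the offset of the crossing point from the midpoint of
  the side. Passing from one crossing to the next subtracts \<open>jump X v + jump Y v\<close>, so trajectories become
  bounded orbits of an explicit rule that is equivariant under the isometries \<open>nu i\<close>. In the sector
  \<open>[0, pi / 8]\<close> such a word is a walk along the path \<open>A - D - B - C\<close> with a loop at \<open>C\<close>; its
  sandwiched letters are the turning points of the walk, and on them the negated offsets follow the same
  rule for the direction \<open>gamma_map v\<close>. Hence derivation acts on directions by the Farey map.

  Two directions with the same expansion have \<open>\<bar>u \<times> z\<bar>\<close> constant along the iteration, while \<open>u \<bullet> z\<close> stays
  non-negative and decreases in each step by at least a fixed multiple of \<open>\<bar>u \<times> z\<bar>\<close>; so \<open>u \<times> z = 0\<close>.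

  A non-periodic word that is admissible in two diagrams \<open>i < j\<close> must have \<open>j = i + 4\<close>, and then it never
  uses the loop. This property is inherited by the derived word, which forces the iterated directions
  into one of two parabolic branches of the Farey map, and these contradict non-periodicity.
\<close>

subsection \<open>Codings of directions\<close>

lemma sqrt2_mult [simp]: "sqrt 2 * (sqrt 2 * x) = 2 * (x::real)"
  by (simp flip: mult.assoc)

lemma sqrt2_bounds: "7 / 5 < sqrt 2" "sqrt 2 < 3 / 2"
  by (rule real_less_rsqrt, simp add: power2_eq_square) (rule real_less_lsqrt, simp_all add: power2_eq_square)

lemma sqrt2_mult_bounds:
  assumes "0 \<le> (x::real)"
  shows "7 / 5 * x \<le> sqrt 2 * x" "sqrt 2 * x \<le> 3 / 2 * x"
  using assms sqrt2_bounds by (simp_all only: mult_right_mono less_imp_le)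

text \<open>Together with \<open>side_dot\<close> this gives the coordinates of \<open>v\<close> in
  an orthonormal frame of a side. For the sides 1 to 4, traversed clockwise, \<open>side_dot\<close>
  is the component along the side and \<open>side_cross\<close> the one along its outward
  normal.\<close>

primrec side_cross :: "letter \<Rightarrow> complex \<Rightarrow> real" where
  "side_cross A v = Im v"
| "side_cross B v = sqrt 2 / 2 * (Re v + Im v)"
| "side_cross C v = Re v"
| "side_cross D v = sqrt 2 / 2 * (Re v - Im v)"

primrec side_dot :: "letter \<Rightarrow> complex \<Rightarrow> real" where
  "side_dot A v = Re v"
| "side_dot B v = sqrt 2 / 2 * (Re v - Im v)"
| "side_dot C v = - Im v"
| "side_dot D v = - (sqrt 2 / 2 * (Re v + Im v))"

text \<open>Twice the cross product of \<open>v\<close> with the midpoint of the side labelled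
  \<open>X\<close> through which the direction \<open>v\<close> leaves the octagon;
  \<open>1 + sqrt 2\<close> is the distance between opposite sides.\<close>

definition jump :: "letter \<Rightarrow> complex \<Rightarrow> real" where
  "jump X v = sgn (side_cross X v) * (1 + sqrt 2) * side_dot X v"

text \<open>The bound places the crossing point strictly inside its side. The equation says that
  twice the cross product of \<open>v\<close> with the position is constant along a chord: it equals
  \<open>a n - jump (w n) v\<close> at the re-entry and
  \<open>a (n + 1) + jump (w (n + 1)) v\<close> at the next hit.\<close>

definition coding :: "complex \<Rightarrow> word \<Rightarrow> (int \<Rightarrow> real) \<Rightarrow> bool" where
  "coding v w a \<longleftrightarrow> (\<forall>n. \<bar>a n\<bar> < \<bar>side_cross (w n) v\<bar> \<and>
     a (n + 1) = a n - jump (w n) v - jump (w (n + 1)) v)"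

definition coded :: "complex \<Rightarrow> word \<Rightarrow> bool" where
  "coded v w \<longleftrightarrow> (\<exists>a. coding v w a)"

lemma codingD:
  assumes "coding v w a"
  shows "\<bar>a n\<bar> < \<bar>side_cross (w n) v\<bar>"
    and "a (n + 1) = a n - jump (w n) v - jump (w (n + 1)) v"
  using assms by (auto simp: coding_def)

lemma letter_cases: "X = A \<or> X = B \<or> X = C \<or> X = D"
  by (cases X) auto

lemma all_letters: "(\<forall>X. P X) \<longleftrightarrow> P A \<and> P B \<and> P C \<and> P D"
  by (metis letter_cases)

lemma diagram_perm_simps:
  "diagram_perm 0 A = A" "diagram_perm 0 B = B" "diagram_perm 0 C = C" "diagram_perm 0 D = D"
  "diagram_perm 1 A = D" "diagram_perm 1 B = C" "diagram_perm 1 C = B" "diagram_perm 1 D = A"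
  "diagram_perm 2 A = B" "diagram_perm 2 B = C" "diagram_perm 2 C = D" "diagram_perm 2 D = A"
  "diagram_perm 3 A = C" "diagram_perm 3 B = B" "diagram_perm 3 C = A" "diagram_perm 3 D = D"
  "diagram_perm 4 A = C" "diagram_perm 4 B = D" "diagram_perm 4 C = A" "diagram_perm 4 D = B"
  "diagram_perm 5 A = B" "diagram_perm 5 B = A" "diagram_perm 5 C = D" "diagram_perm 5 D = C"
  "diagram_perm 6 A = D" "diagram_perm 6 B = A" "diagram_perm 6 C = B" "diagram_perm 6 D = C"
  "diagram_perm 7 A = A" "diagram_perm 7 B = D" "diagram_perm 7 C = C" "diagram_perm 7 D = B"
  by (simp_all add: diagram_perm_def transpose_def eval_nat_numeral)

lemma sector_index_cases:
  assumes "i \<le> (7::nat)"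
  obtains "i = 0" | "i = 1" | "i = 2" | "i = 3" | "i = 4" | "i = 5" | "i = 6" | "i = 7"
  using assms by linarith

section \<open>The cone over \<open>sector 0\<close> and its transitions\<close>

text \<open>The nonzero vectors with angle in \<open>[0, pi / 8]\<close>: \<open>1 + sqrt 2\<close>
  is the cotangent of \<open>pi / 8\<close>.\<close>

definition vcone :: "complex \<Rightarrow> bool" where
  "vcone v \<longleftrightarrow> Re v > 0 \<and> Im v \<ge> 0 \<and> (1 + sqrt 2) * Im v \<le> Re v"

text \<open>Coordinates \<open>p\<close>, \<open>y\<close> along the two boundary rays of the cone, together with
  \<open>P = sqrt 2 * p\<close> and \<open>Y = sqrt 2 * y\<close>, make all inequalities about the cone linear.\<close>

lemma vconeE:
  assumes "vcone v"
  obtains p P y Y where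
    "p \<ge> 0" "y \<ge> 0" "p > 0 \<or> y > 0" "7 / 5 * p \<le> P" "P \<le> 3 / 2 * p" "7 / 5 * y \<le> Y" "Y \<le> 3 / 2 * y"
    "side_cross A v = y" "side_cross B v = P / 2 + Y + y"
    "side_cross C v = p + y + Y" "side_cross D v = P / 2 + y"
    "(1 + sqrt 2) * side_dot A v = p + P + 3 * y + 2 * Y"
    "(1 + sqrt 2) * side_dot B v = p + P / 2 + y + Y"
    "(1 + sqrt 2) * side_dot C v = - y - Y"
    "(1 + sqrt 2) * side_dot D v = - p - P / 2 - 3 * y - 2 * Y"
    "Re v = p + y + Y" "Im v = y" "sqrt 2 * p = P" "sqrt 2 * P = 2 * p" "sqrt 2 * y = Y" "sqrt 2 * Y = 2 * y"
    "side_cross A (gamma_map v) = y" "side_cross B (gamma_map v) = - P / 2 + Y + y"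
    "side_cross C (gamma_map v) = - p + y + Y" "side_cross D (gamma_map v) = - P / 2 + y"
    "(1 + sqrt 2) * side_dot A (gamma_map v) = - p - P + 3 * y + 2 * Y"
    "(1 + sqrt 2) * side_dot B (gamma_map v) = - p - P / 2 + y + Y"
    "(1 + sqrt 2) * side_dot C (gamma_map v) = - y - Y"
    "(1 + sqrt 2) * side_dot D (gamma_map v) = p + P / 2 - 3 * y - 2 * Y"
proof -
  define p y where "p = Re v - (1 + sqrt 2) * Im v" and "y = Im v"
  have nonneg: "p \<ge> 0" "y \<ge> 0" "p > 0 \<or> y > 0"
    using assms by (auto simp: vcone_def p_def y_def)
  have v: "Re v = p + y + sqrt 2 * y" "Im v = y"
    by (auto simp: p_def y_def algebra_simps)
  show ?thesis
    by (rule that[of p y "sqrt 2 * p" "sqrt 2 * y"])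
       (use nonneg sqrt2_mult_bounds[of p] sqrt2_mult_bounds[of y] in
         \<open>simp_all add: v gamma_map_def algebra_simps add_divide_distrib diff_divide_distrib\<close>)
qed

lemma vcone_cross_pos:
  assumes "vcone v" "X \<noteq> A" shows "side_cross X v > 0"
proof -
  obtain p P y Y where v: 
    "p \<ge> 0" "y \<ge> 0" "p > 0 \<or> y > 0" "7 / 5 * p \<le> P" "P \<le> 3 / 2 * p" "7 / 5 * y \<le> Y" "Y \<le> 3 / 2 * y"
    "side_cross A v = y" "side_cross B v = P / 2 + Y + y"
    "side_cross C v = p + y + Y" "side_cross D v = P / 2 + y"
    using assms(1) by (rule vconeE) blast
  have "P / 2 + Y + y > 0 \<and> p + y + Y > 0 \<and> P / 2 + y > 0"
    using v(1-7) by linarith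
  then show ?thesis using assms(2) v by (cases X) (auto simp only:)
qed

lemma vcone_cross_nonneg: "vcone v \<Longrightarrow> side_cross X v \<ge> 0"
  using vcone_cross_pos[of v X] by (cases X) (auto simp: vcone_def)

lemma coding_cross_pos:
  assumes "vcone v" "coding v w a" shows "side_cross (w n) v > 0"
  using codingD(1)[OF assms(2), of n] vcone_cross_nonneg[OF assms(1), of "w n"] by auto

lemma coding_jump:
  assumes "vcone v" "coding v w a" shows "jump (w n) v = (1 + sqrt 2) * side_dot (w n) v"
  using coding_cross_pos[OF assms, of n] by (simp add: jump_def)

definition edge0 :: "letter \<Rightarrow> letter \<Rightarrow> bool" where
  "edge0 X Y \<longleftrightarrow> (X, Y) \<in> {(A, D), (D, A), (D, B), (B, D), (B, C), (C, B), (C, C)}"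

lemma coding_step_bound:
  assumes "vcone v" "coding v w a"
  shows "\<bar>a n\<bar> < side_cross (w n) v"
    "a (n+1) = a n - (1 + sqrt 2) * side_dot (w n) v - (1 + sqrt 2) * side_dot (w (n+1)) v"
  using codingD[OF assms(2), of n] coding_cross_pos[OF assms, of n] coding_jump[OF assms]
  by (simp_all del: side_cross.simps side_dot.simps)

text \<open>For a pair outside the diagram the two midpoints are too far apart, measured across the
  flow, for a chord to join the sides. In cone coordinates each such pair is a linear
  contradiction.\<close>

lemma edge0_if_close:
  assumes "vcone v" "\<bar>(1 + sqrt 2) * side_dot X v + (1 + sqrt 2) * side_dot Y v\<bar>
      < side_cross X v + side_cross Y v"
  shows "edge0 X Y"
proof (rule ccontr)
  assume n: "\<not> edge0 X Y"
  from assms(1) show False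
  proof (rule vconeE, goal_cases)
    case (1 p P y Y')
    note v = 1
    show False using assms(2) n unfolding edge0_def
      by (cases X; cases Y; simp only: v(8-15) abs_less_iff simp_thms insert_iff prod.inject letter.distinct) 
         (use v(1-7) in linarith)+
  qed
qed

lemma coding_edge0:
  assumes "vcone v" "coding v w a" shows "edge0 (w n) (w (n + 1))"
  using coding_step_bound(1)[OF assms, of n] coding_step_bound[OF assms, of n]
    coding_step_bound(1)[OF assms, of "n+1"]
  by (intro edge0_if_close[OF assms(1)]) linarith

lemma admissible0_iff: "admissible0 w \<longleftrightarrow> (\<forall>n. edge0 (w n) (w (n + 1)))"
  by (simp add: admissible0_def edge0_def)

text \<open>Here \<open>h\<close> is the entry height \<open>a n - jump (w n) v\<close>: it decides through which side the
  trajectory leaves, which makes codings deterministic.\<close>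

lemma exit_side_unique:
  assumes "vcone v" "\<bar>h - (1 + sqrt 2) * side_dot X v\<bar> < side_cross X v"
    "\<bar>h - (1 + sqrt 2) * side_dot Y v\<bar> < side_cross Y v"
  shows "X = Y"
proof (rule ccontr)
  assume n: "X \<noteq> Y"
  have less: "\<bar>(1 + sqrt 2) * side_dot X v - (1 + sqrt 2) * side_dot Y v\<bar>
      < side_cross X v + side_cross Y v" using assms by linarith
  from assms(1) show False
  proof (rule vconeE, goal_cases)
    case (1 p P y Y')
    note v = 1
    show False using less n
      by (cases X; cases Y; simp only: v(8-15) abs_less_iff simp_thms letter.distinct) 
         (use v(1-7) in linarith)+
  qed
qed

lemma coding_step_forward:
  assumes v: "vcone v" and c: "coding v w a" and eq: "w n = w m" "a n = a m"
  shows "w (n + 1) = w (m + 1) \<and> a (n + 1) = a (m + 1)"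
proof -
  let ?h = "a n - (1 + sqrt 2) * side_dot (w n) v"
  have a: "a (k + 1) = a k - (1 + sqrt 2) * side_dot (w k) v - (1 + sqrt 2) * side_dot (w (k + 1)) v" for k
    using codingD(2)[OF c, of k] coding_jump[OF v c] by simp
  have "\<bar>?h - (1 + sqrt 2) * side_dot (w (k + 1)) v\<bar> < side_cross (w (k + 1)) v" if "k = n \<or> k = m" for k
    using a[of k] eq codingD(1)[OF c, of "k+1"] coding_cross_pos[OF v c, of "k+1"] that by auto
  then have "w (n + 1) = w (m + 1)" by (intro exit_side_unique[OF v, of ?h]) auto
  then show ?thesis using a[of n] a[of m] eq by simp
qed

text \<open>Time reversal: solving the recurrence for the earlier height and negating it gives the
  form that \<open>exit_side_unique\<close> expects.\<close>

lemma coding_step_backward: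
  assumes v: "vcone v" and c: "coding v w a" and eq: "w (n + 1) = w (m + 1)" "a (n + 1) = a (m + 1)"
  shows "w n = w m \<and> a n = a m"
proof -
  let ?h = "- a (n + 1) - (1 + sqrt 2) * side_dot (w (n + 1)) v"
  have a: "a (k + 1) = a k - (1 + sqrt 2) * side_dot (w k) v - (1 + sqrt 2) * side_dot (w (k + 1)) v" for k
    using codingD(2)[OF c, of k] coding_jump[OF v c] by simp
  have "\<bar>?h - (1 + sqrt 2) * side_dot (w k) v\<bar> < side_cross (w k) v" if "k = n \<or> k = m" for k
    using a[of k] eq codingD(1)[OF c, of k] coding_cross_pos[OF v c, of k] that by auto
  then have "w n = w m" by (intro exit_side_unique[OF v, of ?h]) auto
  then show ?thesis using a[of n] a[of m] eq by simp
qed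

text \<open>Codings are deterministic in both time directions, so one repetition of letter and
  height spreads to all integers.\<close>

lemma coding_recurrence_periodic:
  assumes v: "vcone v" and c: "coding v w a" and eq: "w n = w m" "a n = a m" and "n < m"
  shows "periodic_word w"
proof -
  have f: "w (n + int k) = w (m + int k) \<and> a (n + int k) = a (m + int k)" for k
    using eq by (induction k) (auto simp flip: add.assoc simp: add.commute[of 1] dest: coding_step_forward[OF v c])
  have b: "w (n - int k) = w (m - int k) \<and> a (n - int k) = a (m - int k)" for k
  proof (induction k)
    case (Suc k)
    show ?case
      by (rule coding_step_backward[OF v c]) (use Suc in \<open>auto simp: algebra_simps\<close>)
  qed (use eq in auto)
  have "w (j + (m - n)) = w j" for j
    using f[of "nat (j - n)"] b[of "nat (n - j)"] by (cases "n \<le> j") (auto simp: algebra_simps)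
  then show ?thesis using \<open>n < m\<close> unfolding periodic_word_def by (intro exI[of _ "m - n"]) auto
qed

subsection \<open>Derivation\<close>

text \<open>\<open>turn_sign X Y\<close> is the sign that \<open>side_cross Y (gamma_map v)\<close> is forced to have when
  \<open>X Y X\<close> occurs in the word.\<close>

definition turn_sign :: "letter \<Rightarrow> letter \<Rightarrow> real" where
  "turn_sign X Y = (if (X, Y) \<in> {(D, A), (A, D), (C, B), (B, C)} then 1 else - 1)"

lemma turn_sign_simps:
  "turn_sign D A = 1" "turn_sign A D = 1" "turn_sign C B = 1" "turn_sign B C = 1"
  "turn_sign B D = - 1" "turn_sign D B = - 1" "turn_sign C C = - 1"
  by (simp_all add: turn_sign_def)

lemma edge0_simps:
  "edge0 A X \<longleftrightarrow> X = D" "edge0 D X \<longleftrightarrow> X = A \<or> X = B"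
  "edge0 B X \<longleftrightarrow> X = D \<or> X = C" "edge0 C X \<longleftrightarrow> X = B \<or> X = C"
  by (auto simp: edge0_def)

text \<open>The value of \<open>jump Y (gamma_map v)\<close> forced by an occurrence of
  \<open>X Y X\<close>, but defined for every edge, so that it can be propagated along stretches
  without a turn.\<close>

definition turn_jump :: "complex \<Rightarrow> letter \<Rightarrow> letter \<Rightarrow> real" where
  "turn_jump v X Y = turn_sign X Y * ((1 + sqrt 2) * side_dot Y (gamma_map v))"

text \<open>While the walk does not turn, \<open>turn_jump\<close> changes by exactly the increment
  of the heights; this makes the sum over a run telescope.\<close>

lemma turn_jump_pass:
  assumes "vcone v" "edge0 X Y" "edge0 Y Z" "X \<noteq> Z"
  shows "turn_jump v Y Z = turn_jump v X Y - (1 + sqrt 2) * side_dot Y v - (1 + sqrt 2) * side_dot Z v"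
  using assms(1)
proof (rule vconeE, goal_cases)
  case (1 p P y Y')
  note v = 1
  show ?case using assms(2-4)
    by (cases X; cases Y; simp only: edge0_simps letter.distinct simp_thms; elim disjE;
        simp only: letter.distinct simp_thms)
       (simp_all only: turn_jump_def turn_sign_simps v(12-15) v(26-29) mult_1_left mult_minus1)
qed

text \<open>The first step after a turn goes back along the edge just used, which negates the old
  value before the usual increment is added.\<close>

lemma turn_jump_turn:
  assumes "vcone v" "edge0 X Y"
  shows "turn_jump v Y X = - turn_jump v X Y - (1 + sqrt 2) * side_dot Y v - (1 + sqrt 2) * side_dot X v"
  using assms(1)
proof (rule vconeE, goal_cases)
  case (1 p P y Y')
  note v = 1
  show ?case using assms(2)
    by (cases X; cases Y; simp only: edge0_simps letter.distinct simp_thms)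
       (simp_all only: turn_jump_def turn_sign_simps v(12-15) v(26-29) mult_1_left mult_minus1)
qed

text \<open>The three inequalities are the height bounds at successive crossings of
  \<open>X\<close>, \<open>Y\<close>, \<open>X\<close>. For each edge they imply, linearly, the
  height bound at \<open>Y\<close> for \<open>gamma_map v\<close>, and with it the sign of the cross
  product.\<close>

lemma turn_cross:
  assumes "vcone v" "edge0 X Y"
    "\<bar>a\<bar> < side_cross Y v"
    "\<bar>a + (1 + sqrt 2) * side_dot X v + (1 + sqrt 2) * side_dot Y v\<bar> < side_cross X v"
    "\<bar>a - (1 + sqrt 2) * side_dot X v - (1 + sqrt 2) * side_dot Y v\<bar> < side_cross X v"
  shows "\<bar>a\<bar> < turn_sign X Y * side_cross Y (gamma_map v)"
  using assms(1)
proof (rule vconeE, goal_cases)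
  case (1 p P y Y')
  note v = 1
  show ?case using assms(2-5) unfolding abs_less_iff
    by (cases X; cases Y; simp only: edge0_simps letter.distinct simp_thms)
       (simp_all only: turn_sign_simps v(8-15) v(22-25) mult_1_left mult_minus1, (use v(1-7) in linarith)+)
qed

lemma turn_at:
  assumes v: "vcone v" and c: "coding v w a" and m: "m \<in> sandwiched w"
  shows "\<bar>a m\<bar> < turn_sign (w (m - 1)) (w m) * side_cross (w m) (gamma_map v)"
proof (rule turn_cross[OF v])
  show "edge0 (w (m - 1)) (w m)" using coding_edge0[OF v c, of "m - 1"] by simp
  have s: "w (m - 1) = w (m + 1)" using m by (simp add: sandwiched_def)
  note b = coding_step_bound[OF v c]
  show "\<bar>a m\<bar> < side_cross (w m) v" by (rule b)
  show "\<bar>a m + (1 + sqrt 2) * side_dot (w (m - 1)) v + (1 + sqrt 2) * side_dot (w m) v\<bar> < side_cross (w (m - 1)) v"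
    using b[of "m - 1"] by (simp del: side_cross.simps side_dot.simps)
  show "\<bar>a m - (1 + sqrt 2) * side_dot (w (m - 1)) v - (1 + sqrt 2) * side_dot (w m) v\<bar> < side_cross (w (m - 1)) v"
    using b(2)[of m] b(1)[of "m + 1"] s by (simp add: algebra_simps del: side_cross.simps side_dot.simps)
qed

lemma turn_sgn:
  assumes v: "vcone v" and c: "coding v w a" and m: "m \<in> sandwiched w"
  shows "sgn (side_cross (w m) (gamma_map v)) = turn_sign (w (m - 1)) (w m)"
    "\<bar>a m\<bar> < \<bar>side_cross (w m) (gamma_map v)\<bar>"
    "jump (w m) (gamma_map v) = turn_jump v (w (m - 1)) (w m)"
proof -
  have *: "\<bar>x\<bar> < s * y \<Longrightarrow> s = 1 \<or> s = -1 \<Longrightarrow> sgn y = s \<and> \<bar>x\<bar> < \<bar>y\<bar>" for x y s :: real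
    by (auto simp: sgn_if)
  have **: "turn_sign X Y = 1 \<or> turn_sign X Y = - 1" for X Y by (simp add: turn_sign_def)
  show 1: "sgn (side_cross (w m) (gamma_map v)) = turn_sign (w (m - 1)) (w m)"
    and "\<bar>a m\<bar> < \<bar>side_cross (w m) (gamma_map v)\<bar>"
    using *[OF turn_at[OF assms] **] by auto
  show "jump (w m) (gamma_map v) = turn_jump v (w (m - 1)) (w m)"
    unfolding jump_def turn_jump_def 1 by (simp only: mult.assoc)
qed

text \<open>Telescoping from a turn at \<open>m\<close>: the first step is
  \<open>turn_jump_turn\<close>, because the walk returns to the letter it came from, and every
  later step is \<open>turn_jump_pass\<close>.\<close>

lemma coding_run:
  assumes v: "vcone v" and c: "coding v w a" and m: "m \<in> sandwiched w"
    and no: "\<And>j. m < j \<Longrightarrow> j \<le> m + int k \<Longrightarrow> j \<notin> sandwiched w"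
  shows "a (m + int k + 1) = a m + turn_jump v (w (m - 1)) (w m) + turn_jump v (w (m + int k)) (w (m + int k + 1))"
  using no
proof (induction k)
  case 0
  have s: "w (m - 1) = w (m + 1)" using m by (simp add: sandwiched_def)
  have "edge0 (w (m + 1)) (w m)" using coding_edge0[OF v c, of "m - 1"] s by simp
  from turn_jump_turn[OF v this] coding_step_bound(2)[OF v c, of m] s
  show ?case by (simp del: side_cross.simps side_dot.simps)
next
  case (Suc k)
  let ?j = "m + int (Suc k)"
  have j: "?j \<notin> sandwiched w" using Suc.prems[of ?j] by simp
  have e: "m + int k + 1 = ?j" "?j - 1 = m + int k" by simp_all
  have ih: "a ?j = a m + turn_jump v (w (m - 1)) (w m) + turn_jump v (w (m + int k)) (w ?j)"
    using Suc.IH[OF Suc.prems] unfolding e by simp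
  have "w (m + int k) \<noteq> w (?j + 1)" using j unfolding sandwiched_def mem_Collect_eq e(2) .
  moreover have "edge0 (w (m + int k)) (w ?j)" using coding_edge0[OF v c, of "m + int k"] unfolding e(1) .
  ultimately have "turn_jump v (w ?j) (w (?j + 1)) = turn_jump v (w (m + int k)) (w ?j)
     - (1 + sqrt 2) * side_dot (w ?j) v - (1 + sqrt 2) * side_dot (w (?j + 1)) v"
    using coding_edge0[OF v c, of ?j] by (intro turn_jump_pass[OF v])
  then show ?case using ih coding_step_bound(2)[OF v c, of ?j] by (simp only:)
qed

lemma strict_mono_int_gap:
  fixes f :: "int \<Rightarrow> 'a::linorder"
  assumes "strict_mono f" "range f = S" "f k < j" "j < f (k + 1)"
  shows "j \<notin> S"
proof
  assume "j \<in> S"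
  then obtain i where "j = f i" using assms(2) by auto
  then have "k < i" "i < k + 1" using assms(1,3,4) strict_mono_less by blast+
  then show False by simp
qed

text \<open>Consecutive turns are linked by \<open>coding_run\<close>. The heights change sign
  because \<open>gamma_map\<close> has determinant \<open>-1\<close> and hence negates cross
  products.\<close>

lemma coding_derived:
  assumes v: "vcone v" and c: "coding v w a" and f: "strict_mono f" "range f = sandwiched w"
  shows "coding (gamma_map v) (w \<circ> f) (\<lambda>n. - a (f n))"
  unfolding coding_def
proof (intro allI conjI)
  fix n
  have S: "f k \<in> sandwiched w" for k using f(2) by blast
  show "\<bar>- a (f n)\<bar> < \<bar>side_cross ((w \<circ> f) n) (gamma_map v)\<bar>"
    using turn_sgn(2)[OF v c S[of n]] by simp
  have less: "f n < f (n + 1)" using f(1) by (simp add: strict_mono_def)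
  define k where "k = nat (f (n + 1) - f n - 1)"
  have k: "f n + int k + 1 = f (n + 1)" "f n + int k = f (n + 1) - 1" using less by (auto simp: k_def)
  have "a (f (n + 1)) = a (f n) + turn_jump v (w (f n - 1)) (w (f n)) + turn_jump v (w (f (n + 1) - 1)) (w (f (n + 1)))"
    using coding_run[OF v c S[of n], of k] strict_mono_int_gap[OF f, of n] k(2) unfolding k by simp
  then show "- a (f (n + 1)) = - a (f n) - jump ((w \<circ> f) n) (gamma_map v) - jump ((w \<circ> f) (n + 1)) (gamma_map v)"
    using turn_sgn(3)[OF v c S] by simp
qed

section \<open>Enumerating the sandwiched letters\<close>

text \<open>A walk that never turns follows \<open>A D B C C B D A\<close>. The rank of an edge
  counts the edges left before the forced turn at \<open>A\<close>.\<close>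

definition edge_rank :: "letter \<Rightarrow> letter \<Rightarrow> nat" where
  "edge_rank X Y = (if (X, Y) = (D, A) then 0 else if (X, Y) = (B, D) then 1 else if (X, Y) = (C, B) then 2
     else if (X, Y) = (C, C) then 3 else if (X, Y) = (B, C) then 4 else if (X, Y) = (D, B) then 5 else 6)"

lemma edge_rank_pass:
  assumes "edge0 X Y" "edge0 Y Z" "X \<noteq> Z"
  shows "edge_rank X Y = Suc (edge_rank Y Z)"
  using assms by (cases X; cases Y; cases Z) (simp_all add: edge0_def edge_rank_def)

lemma sandwiched_window:
  assumes "admissible0 w"
  shows "\<exists>m\<in>sandwiched w. n \<le> m \<and> m \<le> n + int (edge_rank (w (n - 1)) (w n))"
  using refl[of "edge_rank (w (n - 1)) (w n)"]
proof (induction "edge_rank (w (n - 1)) (w n)" arbitrary: n)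
  case 0
  have e: "edge0 (w (n - 1)) (w n)" "edge0 (w n) (w (n + 1))"
    using assms unfolding admissible0_iff by (metis diff_add_cancel)+
  have "w (n - 1) = w (n + 1)" using edge_rank_pass[OF e] 0 by auto
  then show ?case by (intro bexI[of _ n]) (auto simp: sandwiched_def)
next
  case (Suc r)
  have e: "edge0 (w (n - 1)) (w n)" "edge0 (w n) (w (n + 1))"
    using assms unfolding admissible0_iff by (metis diff_add_cancel)+
  show ?case
  proof (cases "n \<in> sandwiched w")
    case False
    then have "edge_rank (w (n - 1)) (w n) = Suc (edge_rank (w n) (w (n + 1)))"
      using edge_rank_pass[OF e] by (auto simp: sandwiched_def)
    moreover obtain m where "m \<in> sandwiched w" "n + 1 \<le> m" "m \<le> n + 1 + int (edge_rank (w n) (w (n + 1)))"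
      using Suc(1)[of "n + 1"] Suc(2) calculation by auto
    ultimately show ?thesis by (intro bexI[of _ m]) auto
  qed auto
qed

text \<open>Starting from any element, iterate the next-element map \<open>up_fn\<close> for
  positive indices and the previous-element map \<open>dn_fn\<close> for negative ones.\<close>

lemma ex_int_enumeration:
  fixes S :: "int set"
  assumes up: "\<And>n. \<exists>m\<in>S. n \<le> m" and down: "\<And>n. \<exists>m\<in>S. m \<le> n"
  shows "\<exists>f :: int \<Rightarrow> int. strict_mono f \<and> range f = S"
proof -
  obtain s0 where s0: "s0 \<in> S" using up by blast
  define up_fn where "up_fn n = n + 1 + int (LEAST k. n + 1 + int k \<in> S)" for n
  define dn_fn where "dn_fn n = n - 1 - int (LEAST k. n - 1 - int k \<in> S)" for n
  have upx: "\<exists>k. n + 1 + int k \<in> S" for n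
    using up[of "n + 1"] by (metis zero_le_imp_eq_int diff_ge_0_iff_ge add_diff_cancel_left' diff_add_cancel add.commute)
  have dnx: "\<exists>k. n - 1 - int k \<in> S" for n
  proof -
    obtain m where "m \<in> S" "m \<le> n - 1" using down by blast
    then show ?thesis by (intro exI[of _ "nat (n - 1 - m)"]) auto
  qed
  have up1: "up_fn n \<in> S" "up_fn n > n" for n
    using LeastI_ex[OF upx] by (auto simp: up_fn_def)
  have dn1: "dn_fn n \<in> S" "dn_fn n < n" for n
    using LeastI_ex[OF dnx] by (auto simp: dn_fn_def)
  have up2: "up_fn n \<le> j" if "n < j" "j \<in> S" for n j
    using Least_le[of "\<lambda>k. n + 1 + int k \<in> S" "nat (j - n - 1)"] that by (auto simp: up_fn_def)
  have dn2: "j \<le> dn_fn n" if "j < n" "j \<in> S" for n j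
    using Least_le[of "\<lambda>k. n - 1 - int k \<in> S" "nat (n - 1 - j)"] that by (auto simp: dn_fn_def)
  have updn: "up_fn (dn_fn n) = n" if "n \<in> S" for n
    using up2[of "dn_fn n" n] dn1[of n] up1[of "dn_fn n"] dn2[of "up_fn (dn_fn n)" n] that by force
  define f where "f k = (if k \<ge> 0 then (up_fn ^^ nat k) s0 else (dn_fn ^^ nat (- k)) s0)" for k :: int
  have fS: "f k \<in> S" for k
  proof -
    have "(up_fn ^^ n) s0 \<in> S" "(dn_fn ^^ n) s0 \<in> S" for n
      by (induction n) (auto simp: s0 up1 dn1)
    then show ?thesis by (auto simp: f_def)
  qed
  have step: "f (k + 1) = up_fn (f k)" for k
  proof (cases "k \<ge> 0")
    case True
    then have "nat (k + 1) = Suc (nat k)" by simp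
    then show ?thesis using True by (simp add: f_def)
  next
    case False
    then have e: "nat (- k) = Suc (nat (- (k + 1)))" by simp
    have "f k = dn_fn ((dn_fn ^^ nat (- (k + 1))) s0)" using False by (simp add: f_def e)
    also have "(dn_fn ^^ nat (- (k + 1))) s0 = f (k + 1)" using False by (auto simp: f_def)
    finally show ?thesis using updn fS by simp
  qed
  have lt: "f k < f (k + 1)" for k using step up1 by simp
  have mono': "f k < f (k + 1 + int d)" for k d
  proof (induction d)
    case (Suc d)
    then show ?case using lt[of "k + 1 + int d"] by (simp add: add.assoc add.commute)
  qed (use lt in simp)
  have mono: "strict_mono f"
  proof (rule strict_monoI)
    fix x y :: int assume "x < y"
    then show "f x < f y" using mono'[of x "nat (y - x - 1)"] by simp
  qed
  have growth: "f k + int d \<le> f (k + int d)" for k d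
  proof (induction d)
    case (Suc d)
    then show ?case using lt[of "k + int d"] by (simp add: add.assoc add.commute[of 1])
  qed simp
  have "s \<in> range f" if s: "s \<in> S" for s
  proof -
    \<comment> \<open>The index \<open>b\<close> is far enough to the left that
      \<open>f b \<le> s\<close>. The last index from \<open>b\<close> on with value at most
      \<open>s\<close> must have value \<open>s\<close>, since \<open>up_fn\<close> skips no element
      of \<open>S\<close>.\<close>
    obtain b where b_def: "b = - int (nat (f 0 - s))" by blast
    define k where "k = (GREATEST k. f (b + int k) \<le> s)"
    have b: "f b \<le> s"
      using growth[of b "nat (f 0 - s)"] by (auto simp: b_def)
    have bd: "k' \<le> nat (s - f b)" if "f (b + int k') \<le> s" for k'
      using growth[of b k'] that by simp
    have 1: "f (b + int k) \<le> s"
      unfolding k_def by (rule GreatestI_nat[of "\<lambda>k. f (b + int k) \<le> s" 0]) (use b bd in auto)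
    have 2: "\<not> f (b + int (Suc k)) \<le> s"
      using Greatest_le_nat[of "\<lambda>k. f (b + int k) \<le> s" "Suc k", OF _ bd] unfolding k_def[symmetric] by fastforce
    have "f (b + int (Suc k)) = up_fn (f (b + int k))" using step[of "b + int k"] by (simp add: add.assoc add.commute[of 1])
    then have "\<not> f (b + int k) < s" using 2 up2[of "f (b + int k)" s] s by linarith
    then have "f (b + int k) = s" using 1 by simp
    then show ?thesis by blast
  qed
  then have "range f = S" using fS by auto
  then show ?thesis using mono by blast
qed

lemma sandwiched_enumeration:
  assumes "admissible0 w"
  obtains f where "strict_mono f" "range f = sandwiched w" "derived_word w = w \<circ> f"
proof -
  have r: "edge_rank X Y \<le> 6" for X Y by (simp add: edge_rank_def)
  have "\<exists>f :: int \<Rightarrow> int. strict_mono f \<and> range f = sandwiched w"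
  proof (rule ex_int_enumeration)
    fix n
    show "\<exists>m\<in>sandwiched w. n \<le> m" using sandwiched_window[OF assms, of n] by blast
    \<comment> \<open>Ranks are at most 6, so the window that starts at \<open>n - 6\<close> ends no
      later than \<open>n\<close>.\<close>
    obtain m where "m \<in> sandwiched w" "m \<le> n - 6 + int (edge_rank (w (n - 6 - 1)) (w (n - 6)))"
      using sandwiched_window[OF assms, of "n - 6"] by blast
    then show "\<exists>m\<in>sandwiched w. m \<le> n"
      using r[of "w (n - 6 - 1)" "w (n - 6)"] by (intro bexI[of _ m]) auto
  qed
  from someI_ex[OF this] show ?thesis using that unfolding derived_word_def by blast
qed

section \<open>Derivation preserves non-periodicity\<close>

text \<open>Over one period the height changes by a fixed amount \<open>c0\<close>, and boundedness
  of the heights forces \<open>c0 = 0\<close>. The vector \<open>v\<close> is arbitrary so that the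
  lemma applies to \<open>gamma_map v\<close>.\<close>

lemma coding_periodic_heights:
  assumes c: "coding v w a" and p: "p > 0" "\<And>n. w (n + p) = w n"
  shows "a (n + p) = a n"
proof -
  define c0 where "c0 = a (0 + p) - a 0"
  have step: "a (n + 1 + p) - a (n + 1) = a (n + p) - a n" for n
    using codingD(2)[OF c, of n] codingD(2)[OF c, of "n + p"] p(2)[of n] p(2)[of "n + 1"]
    by (simp add: algebra_simps)
  have const: "a (n + p) - a n = c0" for n
  proof (induction n rule: int_induct[of _ 0])
    case base then show ?case by (simp add: c0_def)
  next
    case (step1 i) then show ?case using step[of i] by simp
  next
    case (step2 i) then show ?case using step[of "i - 1"] by simp
  qed
  have mult: "a (int k * p) = a 0 + real k * c0" for k
  proof (induction k)
    case (Suc k)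
    then show ?case using const[of "int k * p"] by (simp add: algebra_simps)
  qed simp
  define M where "M = \<bar>side_cross (w 0) v\<bar>"
  have "w (int k * p) = w 0" for k
  proof (induction k)
    case (Suc k) then show ?case using p(2)[of "int k * p"] by (simp add: algebra_simps)
  qed simp
  then have bd: "\<bar>a (int k * p)\<bar> < M" for k
    using codingD(1)[OF c, of "int k * p"] by (simp add: M_def)
  have "c0 = 0"
  proof (rule ccontr)
    assume "c0 \<noteq> 0"
    then obtain k where "2 * M < real k * \<bar>c0\<bar>" using reals_Archimedean3[of "\<bar>c0\<bar>"] by auto
    moreover have "\<bar>real k * c0\<bar> < 2 * M" using mult[of k] bd[of k] bd[of 0] by simp
    ultimately show False by (simp add: abs_mult)
  qed
  then show ?thesis using const[of n] by simp
qed

text \<open>If the derived word repeats, so do its heights, which up to sign are heights of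
  \<open>w\<close> at turning points. Letter and height of \<open>w\<close> then recur, and
  \<open>w\<close> is periodic.\<close>

lemma derived_nonperiodic:
  assumes v: "vcone v" and c: "coding v w a" and "\<not> periodic_word w"
  shows "\<not> periodic_word (derived_word w)"
proof
  assume "periodic_word (derived_word w)"
  moreover have "admissible0 w" using coding_edge0[OF v c] by (simp add: admissible0_iff)
  then obtain f where f: "strict_mono f" "range f = sandwiched w" "derived_word w = w \<circ> f"
    by (rule sandwiched_enumeration)
  ultimately obtain p where p: "p > 0" "\<And>n. (w \<circ> f) (n + p) = (w \<circ> f) n"
    unfolding periodic_word_def by auto
  have "- a (f (0 + p)) = - a (f 0)" by (rule coding_periodic_heights[OF coding_derived[OF v c f(1,2)] p])
  then have "periodic_word w"
    by (intro coding_recurrence_periodic[OF v c, of "f 0" "f p"])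
       (use p(2)[of 0] p(1) f(1) in \<open>auto simp: strict_mono_def\<close>)
  with assms show False by simp
qed

lemma coded_derived:
  assumes v: "vcone v" and c: "coded v w"
  shows "coded (gamma_map v) (derived_word w)"
proof -
  obtain a where a: "coding v w a" using c by (auto simp: coded_def)
  have "admissible0 w" using coding_edge0[OF v a] by (simp add: admissible0_iff)
  then obtain f where "strict_mono f" "range f = sandwiched w" "derived_word w = w \<circ> f"
    by (rule sandwiched_enumeration)
  then show ?thesis using coding_derived[OF v a] by (auto simp: coded_def)
qed

subsection \<open>Sectors and the continued fraction\<close>

lemma cis_pi_4: "cis (pi / 4) = Complex (sqrt 2 / 2) (sqrt 2 / 2)"
  by (simp add: complex_eq_iff cos_45 sin_45)

lemma nu_simps:
  "nu 0 v = v"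
  "nu 1 v = Complex (sqrt 2 / 2 * (Re v + Im v)) (sqrt 2 / 2 * (Re v - Im v))"
  "nu 2 v = Complex (sqrt 2 / 2 * (Re v + Im v)) (sqrt 2 / 2 * (Im v - Re v))"
  "nu 3 v = Complex (Im v) (Re v)"
  "nu 4 v = Complex (Im v) (- Re v)"
  "nu 5 v = Complex (sqrt 2 / 2 * (Im v - Re v)) (sqrt 2 / 2 * (Re v + Im v))"
  "nu 6 v = Complex (sqrt 2 / 2 * (Im v - Re v)) (sqrt 2 / 2 * (- Re v - Im v))"
  "nu 7 v = Complex (- Re v) (Im v)"
proof -
  have a: "3 * pi / 4 = pi / 2 + pi / 4" "6 * pi / 8 = pi / 2 + pi / 4" "2 * pi / 8 = pi / 4" "4 * pi / 8 = pi / 2"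
    by simp_all
  have b: "cis (- x) = cnj (cis x)" for x by (simp add: complex_eq_iff)
  have c: "cis (pi / 2 + pi / 4) = Complex (- sqrt 2 / 2) (sqrt 2 / 2)"
    unfolding cis_mult[symmetric] by (simp add: cis_pi_4 complex_eq_iff)
  show "nu 0 v = v" by (simp add: nu_def)
  show "nu 1 v = Complex (sqrt 2 / 2 * (Re v + Im v)) (sqrt 2 / 2 * (Re v - Im v))"
    by (simp add: nu_def complex_eq_iff cos_45 sin_45 algebra_simps)
  show "nu 2 v = Complex (sqrt 2 / 2 * (Re v + Im v)) (sqrt 2 / 2 * (Im v - Re v))"
    by (simp add: nu_def complex_eq_iff cos_45 sin_45 algebra_simps)
  show "nu 3 v = Complex (Im v) (Re v)" by (simp add: nu_def complex_eq_iff)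
  show "nu 4 v = Complex (Im v) (- Re v)" by (simp add: nu_def b a complex_eq_iff)
  show "nu 5 v = Complex (sqrt 2 / 2 * (Im v - Re v)) (sqrt 2 / 2 * (Re v + Im v))"
    using c by (simp add: nu_def a complex_eq_iff algebra_simps)
  show "nu 6 v = Complex (sqrt 2 / 2 * (Im v - Re v)) (sqrt 2 / 2 * (- Re v - Im v))"
    using c by (simp add: nu_def a b complex_eq_iff algebra_simps)
  show "nu 7 v = Complex (- Re v) (Im v)" by (simp add: nu_def complex_eq_iff)
qed

text \<open>The isometry \<open>nu i\<close> moves the side directions as
  \<open>diagram_perm i\<close> moves their labels. The sign \<open>s\<close> may vary with the
  side, but \<open>d\<close> is common to all of them, so every \<open>jump\<close> is multiplied by
  the same constant \<open>d\<close>.\<close>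

lemma nu_side:
  assumes "i \<le> 7"
  shows "\<exists>d\<in>{1, -1}. \<forall>X. \<exists>s\<in>{1, -1}. side_cross (diagram_perm i X) (nu i v) = s * side_cross X v \<and>
      side_dot (diagram_perm i X) (nu i v) = d * s * side_dot X v"
  using assms
proof (cases rule: sector_index_cases)
qed (simp_all only: diagram_perm_simps nu_simps all_letters, 
     simp_all add: field_simps)

lemma coded_nu:
  assumes i: "i \<le> 7" and c: "coded v w"
  shows "coded (nu i v) (diagram_perm i \<circ> w)"
proof -
  obtain a where a: "coding v w a" using c by (auto simp: coded_def)
  obtain d where d: "d \<in> {1, -1}" and ds: "\<And>X. \<exists>s\<in>{1, -1}. side_cross (diagram_perm i X) (nu i v) = s * side_cross X v \<and>
      side_dot (diagram_perm i X) (nu i v) = d * s * side_dot X v"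
    using nu_side[OF i] by meson
  have j: "jump (diagram_perm i X) (nu i v) = d * jump X v" for X
    using ds[of X] d by (auto simp: jump_def sgn_if)
  have l: "\<bar>side_cross (diagram_perm i X) (nu i v)\<bar> = \<bar>side_cross X v\<bar>" for X
    using ds[of X] by auto
  have "coding (nu i v) (diagram_perm i \<circ> w) (\<lambda>n. d * a n)"
    unfolding coding_def using codingD[OF a] d by (auto simp: j l algebra_simps simp del: side_cross.simps)
  then show ?thesis by (auto simp: coded_def)
qed

lemma side_scale:
  "side_cross X (of_real r * v) = r * side_cross X v" "side_dot X (of_real r * v) = r * side_dot X v"
  by (cases X; simp add: algebra_simps)+

lemma coded_scale:
  assumes r: "r > 0" and c: "coded v w"
  shows "coded (of_real r * v) w"
proof -
  obtain a where a: "coding v w a" using c by (auto simp: coded_def)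
  have j: "jump X (of_real r * v) = r * jump X v" for X
    using r by (simp add: jump_def side_scale sgn_mult)
  have "coding (of_real r * v) w (\<lambda>n. r * a n)"
    unfolding coding_def using codingD[OF a] r
    by (simp add: j side_scale abs_mult right_diff_distrib)
  then show ?thesis by (auto simp: coded_def)
qed

lemma coded_unscale:
  assumes "r > 0" "coded (of_real r * v) w"
  shows "coded v w"
  using coded_scale[of "inverse r", OF _ assms(2)] assms(1) by (simp flip: mult.assoc of_real_mult)

lemma vcone_scale: "r > 0 \<Longrightarrow> vcone (of_real r * v) \<longleftrightarrow> vcone v"
  unfolding vcone_def by (simp add: zero_less_mult_iff zero_le_mult_iff mult.left_commute[of _ r])

lemma nu_scale: "nu i (of_real r * v) = of_real r * nu i v"
  by (simp add: nu_def algebra_simps)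

lemma gamma_map_scale: "gamma_map (of_real r * v) = of_real r * gamma_map v"
  by (simp add: gamma_map_def complex_eq_iff algebra_simps)

text \<open>The two cosines agree at \<open>t = pi / 8\<close>, so comparing an angle with
  \<open>pi / 8\<close> reduces to monotonicity of the cosine.\<close>

lemma cos_sin_diff: "cos t - (1 + sqrt 2) * sin t = sqrt 2 * (cos (t + pi / 4) - cos (pi / 2 - t))"
  by (simp add: cos_add cos_diff cos_45 sin_45 algebra_simps)

lemma vcone_cis:
  assumes "0 \<le> t" "t \<le> pi / 8" shows "vcone (cis t)"
proof -
  have "cos (pi / 2 - t) \<le> cos (t + pi / 4)"
    by (rule cos_monotone_0_pi_le) (use assms in auto)
  then have "(1 + sqrt 2) * sin t \<le> cos t" using cos_sin_diff[of t]
    by (smt (verit) mult_nonneg_nonneg real_sqrt_ge_zero)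
  moreover have "cos t > 0" by (rule cos_gt_zero_pi) (use assms pi_gt_zero in linarith)+
  moreover have "sin t \<ge> 0" by (rule sin_ge_zero) (use assms pi_gt_zero in linarith)+
  ultimately show ?thesis by (simp add: vcone_def)
qed

lemma cis_below_sector:
  assumes "0 \<le> t" "t < pi / 8" shows "(1 + sqrt 2) * sin t < cos t"
proof -
  have "cos (pi / 2 - t) < cos (t + pi / 4)"
    by (rule cos_monotone_0_pi) (use assms in auto)
  then have "sqrt 2 * (cos (t + pi / 4) - cos (pi / 2 - t)) > 0" by simp
  then show ?thesis using cos_sin_diff[of t] by simp
qed

lemma nu_cis: "nu i (cis \<theta>) = cis (if even i then \<theta> - real i * pi / 8 else (real i + 1) * pi / 8 - \<theta>)"
  by (simp add: nu_def cis_mult cis_cnj algebra_simps)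

lemma vcone_nu:
  assumes "\<theta> \<in> sector i" shows "vcone (nu i (cis \<theta>))"
  unfolding nu_cis by (rule vcone_cis) (use assms in \<open>auto simp: sector_def field_simps\<close>)

lemma cis_real_multiple_unique:
  assumes "of_real c * cis \<phi> = of_real c' * cis \<psi>" "c \<noteq> 0" "\<bar>\<phi> - \<psi>\<bar> < pi"
  shows "\<phi> = \<psi>"
proof -
  have "of_real c * cis \<phi> * cis (- \<psi>) = of_real c' * (cis \<psi> * cis (- \<psi>))"
    using assms(1) by (simp add: mult.assoc)
  then have "of_real c * cis (\<phi> - \<psi>) = of_real c'" by (simp add: mult.assoc cis_mult)
  then have "c * sin (\<phi> - \<psi>) = 0" by (simp add: complex_eq_iff)
  then have "sin (\<phi> - \<psi>) = 0" using assms(2) by simp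
  then show ?thesis using assms(3) sin_eq_0_pi[of "\<phi> - \<psi>"] by (simp add: abs_less_iff)
qed

lemma gamma_map_vcone:
  assumes "vcone v"
  shows "Im (gamma_map v) \<ge> 0" "Im (gamma_map v) = 0 \<longrightarrow> Re (gamma_map v) < 0"
    "Re (gamma_map v) \<le> (1 + sqrt 2) * Im (gamma_map v)"
  using assms by (auto simp: gamma_map_def vcone_def algebra_simps)

text \<open>The image vector lies in the closed upper half plane and off the non-negative real axis.
  Its argument is therefore the unique angle in \<open>(0, pi]\<close> spanning the same line, and
  the scalar can be taken positive.\<close>

lemma farey_spec:
  assumes "\<theta> \<in> sector i"
  obtains c where "c > 0" "gamma_map (nu i (cis \<theta>)) = of_real c * cis (farey i \<theta>)"
    "pi / 8 \<le> farey i \<theta>" "farey i \<theta> \<le> pi"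
proof -
  define z where "z = gamma_map (nu i (cis \<theta>))"
  note zp = gamma_map_vcone[OF vcone_nu[OF assms], folded z_def]
  have z0: "z \<noteq> 0" using zp by auto
  have z: "z = of_real (norm z) * cis (Arg z)" using rcis_cmod_Arg[of z] by (simp add: rcis_def)
  have sin0: "sin (Arg z) \<ge> 0" 
    using zp(1) z0 by (subst (asm) z) (auto simp: zero_le_mult_iff)
  have a: "Arg z \<le> pi" "- pi < Arg z" using Arg_bounded[of z] by auto
  have pos: "0 < Arg z"
  proof (rule ccontr)
    assume n: "\<not> 0 < Arg z"
    have "sin (- Arg z) \<le> 0" using sin0 by simp
    then have "Arg z = 0" using sin_gt_zero[of "- Arg z"] n a by force
    then have "z = of_real (norm z)" using z by simp
    then have "Im z = 0" "Re z \<ge> 0" by (metis Im_complex_of_real, metis Re_complex_of_real norm_ge_zero)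
    then show False using zp(2) by simp
  qed
  have ge: "pi / 8 \<le> Arg z"
  proof (rule ccontr)
    assume "\<not> pi / 8 \<le> Arg z"
    then have "(1 + sqrt 2) * sin (Arg z) < cos (Arg z)" using cis_below_sector[of "Arg z"] pos by simp
    then have "norm z * ((1 + sqrt 2) * sin (Arg z)) < norm z * cos (Arg z)" using z0 by simp
    moreover have "Re z = norm z * cos (Arg z)" "Im z = norm z * sin (Arg z)"
      by (subst z, simp)+
    ultimately show False using zp(3) by (simp add: algebra_simps)
  qed
  have "farey i \<theta> = Arg z"
    unfolding farey_def z_def[symmetric]
  proof (rule the_equality)
    show "0 < Arg z \<and> Arg z \<le> pi \<and> (\<exists>c. c \<noteq> 0 \<and> z = complex_of_real c * cis (Arg z))"
      using pos a z z0 by (auto intro!: exI[of _ "norm z"])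
    fix \<phi> assume p: "0 < \<phi> \<and> \<phi> \<le> pi \<and> (\<exists>c. c \<noteq> 0 \<and> z = complex_of_real c * cis \<phi>)"
    then obtain c where c: "c \<noteq> 0" "z = complex_of_real c * cis \<phi>" by blast
    show "\<phi> = Arg z"
      by (rule cis_real_multiple_unique[of c _ "norm z"]) (use c z p pos a in auto)
  qed
  then show ?thesis using that[of "norm z"] z z0 ge a unfolding z_def[symmetric] by simp
qed

lemma coded_farey:
  assumes i: "i \<le> 7" and s: "\<theta> \<in> sector i" and c: "coded (cis \<theta>) w"
  shows "coded (cis (farey i \<theta>)) (derived_word (diagram_perm i \<circ> w))"
proof -
  obtain r where r: "r > 0" "gamma_map (nu i (cis \<theta>)) = of_real r * cis (farey i \<theta>)"
    using farey_spec[OF s] by metis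
  show ?thesis
    by (rule coded_unscale[OF r(1)], fold r(2)) (rule coded_derived[OF vcone_nu[OF s] coded_nu[OF i c]])
qed

lemma admissible_sector:
  assumes i: "i \<le> 7" and s: "\<theta> \<in> sector i" and c: "coded (cis \<theta>) w"
  shows "admissible i w"
  using coded_nu[OF i c] coding_edge0[OF vcone_nu[OF s]]
  unfolding admissible_def admissible0_iff coded_def by blast

lemma inj_diagram_perm:
  assumes "i \<le> 7" shows "inj (diagram_perm i)"
  unfolding inj_def using assms
  by (cases rule: sector_index_cases) (simp_all only: all_letters diagram_perm_simps, simp_all)

lemma periodic_diagram_perm:
  assumes "i \<le> 7" shows "periodic_word (diagram_perm i \<circ> w) \<longleftrightarrow> periodic_word w"
  using injD[OF inj_diagram_perm[OF assms]] unfolding periodic_word_def by (auto simp: inj_eq[OF inj_diagram_perm[OF assms]])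

lemma nonperiodic_farey:
  assumes i: "i \<le> 7" and s: "\<theta> \<in> sector i" and c: "coded (cis \<theta>) w" and "\<not> periodic_word w"
  shows "\<not> periodic_word (derived_word (diagram_perm i \<circ> w))"
  using coded_nu[OF i c] derived_nonperiodic[OF vcone_nu[OF s]] periodic_diagram_perm[OF i] assms(4)
  unfolding coded_def by blast

section \<open>Iterated Farey maps and uniqueness of the direction with a given expansion\<close>

primrec cf_iter :: "(nat \<Rightarrow> nat) \<Rightarrow> real \<Rightarrow> nat \<Rightarrow> real" where
  "cf_iter s \<theta> 0 = \<theta>"
| "cf_iter s \<theta> (Suc k) = farey (s k) (cf_iter s \<theta> k)"

lemma cf_iter_shift: "cf_iter s \<theta> (Suc k) = cf_iter (\<lambda>k. s (Suc k)) (farey (s 0) \<theta>) k"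
  by (induction k) simp_all

lemma cf_cell_iff:
  "\<theta> \<in> cf_cell (map s [0..<n]) \<longleftrightarrow> cf_iter s \<theta> n \<in> {0..pi} \<and> (\<forall>k<n. cf_iter s \<theta> k \<in> sector (s k))"
proof (induction n arbitrary: s \<theta>)
  case (Suc n)
  have "map s [0..<Suc n] = s 0 # map (\<lambda>k. s (Suc k)) [0..<n]" by (rule map_upt_Suc)
  then have "\<theta> \<in> cf_cell (map s [0..<Suc n]) \<longleftrightarrow>
      \<theta> \<in> sector (s 0) \<and> cf_iter s \<theta> (Suc n) \<in> {0..pi} \<and> (\<forall>k<n. cf_iter s \<theta> (Suc k) \<in> sector (s (Suc k)))"
    by (simp only: cf_cell.simps mem_Collect_eq Suc.IH cf_iter_shift)
  then show ?case by (auto simp add: All_less_Suc2 simp del: cf_iter.simps(2))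
qed simp

definition cvec_dot :: "complex \<Rightarrow> complex \<Rightarrow> real" where "cvec_dot u z = Re u * Re z + Im u * Im z"
definition cvec_cross :: "complex \<Rightarrow> complex \<Rightarrow> real" where "cvec_cross u z = Re u * Im z - Im u * Re z"

lemma cvec_nu:
  shows "cvec_dot (nu i u) (nu i z) = cvec_dot u z" "\<bar>cvec_cross (nu i u) (nu i z)\<bar> = \<bar>cvec_cross u z\<bar>"
proof -
  have d: "cvec_dot u z = Re (cnj u * z)" and c: "cvec_cross u z = Im (cnj u * z)" for u z
    by (simp_all add: cvec_dot_def cvec_cross_def)
  have k: "cnj (cis t) * cis t = 1" for t by (simp add: cis_cnj cis_mult)
  have "cnj (nu i u) * nu i z = (if even i then cnj u * z else cnj (cnj u * z))"
  proof (cases "even i")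
    case True
    then have "cnj (nu i u) * nu i z = (cnj (cis (- (real i * pi / 8))) * cis (- (real i * pi / 8))) * (cnj u * z)"
      by (simp add: nu_def ac_simps)
    then show ?thesis using True by (simp only: k) simp
  next
    case False
    then have "cnj (nu i u) * nu i z = (cnj (cis ((real i + 1) * pi / 8)) * cis ((real i + 1) * pi / 8)) * (u * cnj z)"
      by (simp add: nu_def ac_simps)
    then show ?thesis using False by (simp only: k) simp
  qed
  then show "cvec_dot (nu i u) (nu i z) = cvec_dot u z" "\<bar>cvec_cross (nu i u) (nu i z)\<bar> = \<bar>cvec_cross u z\<bar>"
    unfolding d c by auto
qed

text \<open>In the cone coordinates \<open>p\<close>, \<open>q\<close> the cross product is
  \<open>p * Im z - q * Im u\<close>, while the dot product drops by
  \<open>2 * K * (p * Im z + q * Im u)\<close>; all four coordinates are non-negative.\<close>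

lemma cvec_gamma:
  assumes "vcone u" "vcone z"
  shows "\<bar>cvec_cross (gamma_map u) (gamma_map z)\<bar> = \<bar>cvec_cross u z\<bar>"
    "cvec_dot (gamma_map u) (gamma_map z) \<le> cvec_dot u z - 2 * (1 + sqrt 2) * \<bar>cvec_cross u z\<bar>"
proof -
  define K where "K = 1 + sqrt 2"
  have K: "K > 0" by (simp add: K_def add_pos_pos)
  define p q where "p = Re u - K * Im u" and "q = Re z - K * Im z"
  have n: "p \<ge> 0" "q \<ge> 0" "Im u \<ge> 0" "Im z \<ge> 0"
    using assms by (auto simp: vcone_def p_def q_def K_def)
  have g: "Re (gamma_map v) = - Re v + 2 * K * Im v" "Im (gamma_map v) = Im v" for v
    by (simp_all add: gamma_map_def K_def)
  have "cvec_cross (gamma_map u) (gamma_map z) = - cvec_cross u z"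
    by (simp add: cvec_cross_def g algebra_simps)
  then show "\<bar>cvec_cross (gamma_map u) (gamma_map z)\<bar> = \<bar>cvec_cross u z\<bar>" by simp
  have "cvec_dot u z - cvec_dot (gamma_map u) (gamma_map z) = 2 * K * (p * Im z + q * Im u)"
    by (simp add: cvec_dot_def g p_def q_def algebra_simps)
  moreover have "cvec_cross u z = p * Im z - q * Im u"
    by (simp add: cvec_cross_def p_def q_def algebra_simps)
  then have "\<bar>cvec_cross u z\<bar> \<le> p * Im z + q * Im u" using n by (simp add: abs_le_iff)
  then have "2 * K * \<bar>cvec_cross u z\<bar> \<le> 2 * K * (p * Im z + q * Im u)" using K by (intro mult_left_mono) auto
  ultimately show "cvec_dot (gamma_map u) (gamma_map z) \<le> cvec_dot u z - 2 * (1 + sqrt 2) * \<bar>cvec_cross u z\<bar>"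
    unfolding K_def by linarith
qed

text \<open>The vectors are not normalised, so that cross products are preserved up to sign.\<close>

primrec cf_vec :: "(nat \<Rightarrow> nat) \<Rightarrow> real \<Rightarrow> nat \<Rightarrow> complex" where
  "cf_vec s \<theta> 0 = cis \<theta>"
| "cf_vec s \<theta> (Suc k) = gamma_map (nu (s k) (cf_vec s \<theta> k))"

lemma cf_vec_iter:
  assumes "\<And>k. cf_iter s \<theta> k \<in> sector (s k)"
  shows "\<exists>r>0. cf_vec s \<theta> k = of_real r * cis (cf_iter s \<theta> k)"
proof (induction k)
  case 0 then show ?case by (intro exI[of _ 1]) simp
next
  case (Suc k)
  then obtain r where r: "r > 0" "cf_vec s \<theta> k = of_real r * cis (cf_iter s \<theta> k)" by blast
  obtain c where "c > 0" "gamma_map (nu (s k) (cis (cf_iter s \<theta> k))) = of_real c * cis (cf_iter s \<theta> (Suc k))"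
    using farey_spec[OF assms[of k]] by auto
  then show ?case using r by (intro exI[of _ "r * c"]) (simp add: nu_scale gamma_map_scale)
qed

lemma cf_unique:
  assumes a: "\<And>k. cf_iter s \<theta> k \<in> sector (s k)" and b: "\<And>k. cf_iter s \<phi> k \<in> sector (s k)"
  shows "\<theta> = \<phi>"
proof -
  define u z where "u = cf_vec s \<theta>" and "z = cf_vec s \<phi>"
  have cone: "vcone (nu (s k) (u k))" "vcone (nu (s k) (z k))" for k
    using cf_vec_iter[of s, OF a, of k] cf_vec_iter[of s, OF b, of k] vcone_nu[OF a[of k]] vcone_nu[OF b[of k]]
    by (auto simp: u_def z_def nu_scale vcone_scale)
  have st: "u (Suc k) = gamma_map (nu (s k) (u k))" "z (Suc k) = gamma_map (nu (s k) (z k))" for k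
    by (simp_all add: u_def z_def)
  define c where "c = \<bar>cvec_cross (u 0) (z 0)\<bar>"
  have cross: "\<bar>cvec_cross (u k) (z k)\<bar> = c" for k
    by (induction k) (simp_all add: c_def st cvec_gamma(1)[OF cone] cvec_nu)
  have dot: "cvec_dot (u k) (z k) \<le> cvec_dot (u 0) (z 0) - real k * (2 * (1 + sqrt 2) * c)" for k
  proof (induction k)
    case (Suc k)
    have "cvec_dot (u (Suc k)) (z (Suc k)) \<le> cvec_dot (u k) (z k) - 2 * (1 + sqrt 2) * c"
      using cvec_gamma(2)[OF cone(1)[of k] cone(2)[of k]] by (simp add: st cvec_nu cross)
    then show ?case using Suc by (simp add: algebra_simps)
  qed simp
  \<comment> \<open>Both iterates lie in the same sector, so the angle between them is
    acute.\<close>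
  have nonneg: "cvec_dot (u k) (z k) \<ge> 0" for k
  proof -
    obtain r r' where r: "r > 0" "u k = of_real r * cis (cf_iter s \<theta> k)" "r' > 0" "z k = of_real r' * cis (cf_iter s \<phi> k)"
      using cf_vec_iter[of s, OF a, of k] cf_vec_iter[of s, OF b, of k] by (auto simp: u_def z_def)
    then have "cvec_dot (u k) (z k) = r * r' * cos (cf_iter s \<theta> k - cf_iter s \<phi> k)"
      by (simp add: cvec_dot_def cos_diff algebra_simps)
    moreover have "cos (cf_iter s \<theta> k - cf_iter s \<phi> k) \<ge> 0"
      by (rule cos_ge_zero) (use a[of k] b[of k] in \<open>auto simp: sector_def field_simps\<close>)
    ultimately show ?thesis using r by simp
  qed
  have "c = 0"
  proof (rule ccontr)
    assume "c \<noteq> 0"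
    then have "0 < 2 * (1 + sqrt 2) * c" by (simp add: c_def add_pos_pos zero_less_mult_iff)
    then obtain k where "cvec_dot (u 0) (z 0) < real k * (2 * (1 + sqrt 2) * c)"
      using reals_Archimedean3 by blast
    then show False using dot[of k] nonneg[of k] by linarith
  qed
  then have "sin (\<phi> - \<theta>) = 0"
    by (simp add: c_def u_def z_def cvec_cross_def sin_diff algebra_simps)
  moreover have "\<bar>\<phi> - \<theta>\<bar> < pi"
    using a[of 0] b[of 0] pi_gt_zero by (simp add: sector_def abs_less_iff field_simps del: pi_gt_zero)
  ultimately have "\<phi> - \<theta> = 0" using sin_eq_0_pi[of "\<phi> - \<theta>"] by (simp add: abs_less_iff)
  then show ?thesis by simp
qed

lemma octagon_cf_if_iter:
  assumes s: "s \<in> S_star" and a: "\<And>k. cf_iter s \<theta> k \<in> sector (s k)" and r: "\<And>k. cf_iter s \<theta> k \<in> {0..pi}"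
  shows "octagon_cf \<theta> s"
  unfolding octagon_cf_def
proof (intro conjI equalityI subsetI)
  show "s \<in> S_star" by (rule s)
  fix \<phi>
  assume "\<phi> \<in> (\<Inter>k. cf_cell (map s [0..<Suc k]))"
  then have "\<phi> \<in> cf_cell (map s [0..<Suc k])" for k by blast
  then have "cf_iter s \<phi> k \<in> sector (s k)" for k unfolding cf_cell_iff by blast
  then show "\<phi> \<in> {\<theta>}" using cf_unique[OF a] by blast
next
  fix \<phi> assume "\<phi> \<in> {\<theta>}"
  then have "\<phi> \<in> cf_cell (map s [0..<Suc k])" for k using a r[of "Suc k"] by (auto simp: cf_cell_iff simp del: cf_iter.simps upt_Suc)
  then show "\<phi> \<in> (\<Inter>k. cf_cell (map s [0..<Suc k]))" by blast
qed

subsection \<open>Uniqueness of the diagram\<close>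

declare One_nat_def [simp del]

lemma periodic_if_step2: "(\<And>n. w (n + 2) = w n) \<Longrightarrow> periodic_word w"
  unfolding periodic_word_def by (intro exI[of _ 2]) auto

lemma periodic_if_two_letters:
  assumes "\<And>n. (w n, w (n + 1)) \<in> {(X, Y), (Y, X)}"
  shows "periodic_word w"
proof (rule periodic_if_step2)
  fix n show "w (n + 2) = w n" using assms[of n] assms[of "n + 1"] by (auto simp: add.assoc)
qed

primrec letter_rank :: "letter \<Rightarrow> nat" where
  "letter_rank A = 0" | "letter_rank D = 1" | "letter_rank B = 2" | "letter_rank C = 3"

definition up_edge :: "letter \<Rightarrow> letter \<Rightarrow> bool" where
  "up_edge X Y \<longleftrightarrow> (X, Y) \<in> {(A, D), (D, B), (B, C)}"

definition no_loop :: "word \<Rightarrow> bool" where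
  "no_loop w \<longleftrightarrow> (\<forall>n. (w n, w (n + 1)) \<noteq> (C, C))"

lemma edge0_up: "edge0 X Y \<Longrightarrow> (X, Y) \<noteq> (C, C) \<Longrightarrow> up_edge X Y \<or> up_edge Y X"
  by (cases X; cases Y) (simp_all add: edge0_def up_edge_def)

lemma up_edge_pass:
  "up_edge X Y \<Longrightarrow> up_edge Y Z \<or> up_edge Z Y \<Longrightarrow> X \<noteq> Z \<Longrightarrow> up_edge Y Z"
  "up_edge Y X \<Longrightarrow> up_edge Y Z \<or> up_edge Z Y \<Longrightarrow> X \<noteq> Z \<Longrightarrow> up_edge Z Y"
  by (auto simp: up_edge_def)

lemma up_edge_rank: "up_edge X Y \<Longrightarrow> letter_rank X < letter_rank Y"
  by (auto simp: up_edge_def)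

text \<open>Between two turns the walk keeps its direction and is strictly monotone in
  \<open>letter_rank\<close>. Ascending and descending runs are treated in one induction.\<close>

lemma monotone_run:
  assumes e: "\<And>n. up_edge (w n) (w (n + 1)) \<or> up_edge (w (n + 1)) (w n)"
    and no: "\<And>j. m < j \<Longrightarrow> j \<le> m + int k \<Longrightarrow> j \<notin> sandwiched w"
  shows "(up_edge (w m) (w (m + 1)) \<longrightarrow>
       letter_rank (w m) < letter_rank (w (m + int k + 1)) \<and> up_edge (w (m + int k)) (w (m + int k + 1))) \<and>
     (up_edge (w (m + 1)) (w m) \<longrightarrow>
       letter_rank (w (m + int k + 1)) < letter_rank (w m) \<and> up_edge (w (m + int k + 1)) (w (m + int k)))"
  using no
proof (induction k)
  case 0
  show ?case by (auto dest: up_edge_rank)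
next
  case (Suc k)
  let ?j = "m + int (Suc k)"
  have eq: "m + int k + 1 = ?j" "?j - 1 = m + int k" by simp_all
  have ih: "(up_edge (w m) (w (m + 1)) \<longrightarrow> letter_rank (w m) < letter_rank (w ?j) \<and> up_edge (w (m + int k)) (w ?j)) \<and>
     (up_edge (w (m + 1)) (w m) \<longrightarrow> letter_rank (w ?j) < letter_rank (w m) \<and> up_edge (w ?j) (w (m + int k)))"
    using Suc.IH[OF Suc.prems] unfolding eq by simp
  have "?j \<notin> sandwiched w" using Suc.prems[of ?j] by simp
  then have ne: "w (m + int k) \<noteq> w (?j + 1)" unfolding sandwiched_def mem_Collect_eq eq(2) .
  show ?case using ih up_edge_pass[OF _ e[of ?j] ne] up_edge_rank by (meson less_trans)
qed

text \<open>In a word without \<open>C C\<close> the sandwiched letters are the local minima and maxima with respect to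
  the order \<open>A < D < B < C\<close>, and these alternate.\<close>

definition lower_turn :: "complex \<Rightarrow> letter \<Rightarrow> bool" where
  "lower_turn u Y \<longleftrightarrow> Y \<noteq> C \<and> (Y = D \<longrightarrow> side_cross D u < 0) \<and> (Y = B \<longrightarrow> side_cross B u > 0)"

definition upper_turn :: "complex \<Rightarrow> letter \<Rightarrow> bool" where
  "upper_turn u Z \<longleftrightarrow> Z \<noteq> A \<and> (Z = D \<longrightarrow> side_cross D u > 0) \<and> (Z = B \<longrightarrow> side_cross B u < 0) \<and>
     (Z = C \<longrightarrow> side_cross C u > 0)"

definition turn_pair :: "complex \<Rightarrow> letter \<Rightarrow> letter \<Rightarrow> bool" where
  "turn_pair u Y Z \<longleftrightarrow> letter_rank Y < letter_rank Z \<and> lower_turn u Y \<and> upper_turn u Z"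

section \<open>Non-periodic words that avoid the loop do not exist\<close>

definition tame :: "complex \<Rightarrow> word \<Rightarrow> bool" where
  "tame v w \<longleftrightarrow> vcone v \<and> coded v w \<and> \<not> periodic_word w \<and> no_loop w"

text \<open>Successive turns are a local minimum and a local maximum in some order, and
  \<open>turn_sgn\<close> converts each of them into sign conditions on
  \<open>gamma_map v\<close>.\<close>

lemma tame_derived:
  assumes "tame v w"
  shows "coded (gamma_map v) (derived_word w)" "\<not> periodic_word (derived_word w)"
    "turn_pair (gamma_map v) (derived_word w n) (derived_word w (n + 1)) \<or>
     turn_pair (gamma_map v) (derived_word w (n + 1)) (derived_word w n)"
proof -
  have v: "vcone v" and "coded v w" and np: "\<not> periodic_word w" and nl: "no_loop w"
    using assms by (auto simp: tame_def)
  then obtain a where c: "coding v w a" by (auto simp: coded_def)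
  show "coded (gamma_map v) (derived_word w)" by (rule coded_derived[OF v \<open>coded v w\<close>])
  show "\<not> periodic_word (derived_word w)" by (rule derived_nonperiodic[OF v c np])
  have adm: "admissible0 w" using coding_edge0[OF v c] by (simp add: admissible0_iff)
  have e: "up_edge (w k) (w (k + 1)) \<or> up_edge (w (k + 1)) (w k)" for k
    using edge0_up[OF coding_edge0[OF v c]] nl by (simp add: no_loop_def)
  have lower: "lower_turn (gamma_map v) (w m)" if "m \<in> sandwiched w" "up_edge (w m) (w (m - 1))" for m
    using turn_sgn(1)[OF v c that(1)] that(2) unfolding up_edge_def lower_turn_def
    by (auto simp: turn_sign_simps sgn_if split: if_splits simp del: side_cross.simps)
  have upper: "upper_turn (gamma_map v) (w m)" if "m \<in> sandwiched w" "up_edge (w (m - 1)) (w m)" for m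
    using turn_sgn(1)[OF v c that(1)] that(2) unfolding up_edge_def upper_turn_def
    by (auto simp: turn_sign_simps sgn_if split: if_splits simp del: side_cross.simps)
  obtain f where f: "strict_mono f" "range f = sandwiched w" "derived_word w = w \<circ> f"
    using adm by (rule sandwiched_enumeration)
  have S: "f k \<in> sandwiched w" for k using f(2) by blast
  have less: "f n < f (n + 1)" using f(1) by (simp add: strict_mono_def)
  define k where "k = nat (f (n + 1) - f n - 1)"
  have k: "f n + int k + 1 = f (n + 1)" "f n + int k = f (n + 1) - 1" using less by (auto simp: k_def)
  have "j \<notin> sandwiched w" if "f n < j" "j \<le> f n + int k" for j
    using strict_mono_int_gap[OF f(1,2), of n j] that k(2) by auto
  note run = monotone_run[of w "f n" k, OF e this, unfolded k(1), unfolded k(2)]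
  have s: "w (f n - 1) = w (f n + 1)" using S[of n] by (simp add: sandwiched_def)
  show "turn_pair (gamma_map v) (derived_word w n) (derived_word w (n + 1)) \<or>
     turn_pair (gamma_map v) (derived_word w (n + 1)) (derived_word w n)"
    using e[of "f n"] run lower[OF S, of n] upper[OF S, of n] lower[OF S, of "n + 1"] upper[OF S, of "n + 1"]
    unfolding s turn_pair_def f(3) o_def by blast
qed

lemma coded_edge0_nu:
  assumes "vcone (nu i u)" "i \<le> 7" "coded u w"
  shows "edge0 (diagram_perm i (w n)) (diagram_perm i (w (n + 1)))"
  using coded_nu[OF assms(2,3)] coding_edge0[OF assms(1)] unfolding coded_def by fastforce

lemma tame_nu:
  assumes "vcone (nu i u)" "i \<le> 7" "coded u w" "\<not> periodic_word w" "no_loop (diagram_perm i \<circ> w)"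
  shows "tame (nu i u) (diagram_perm i \<circ> w)"
  using assms coded_nu periodic_diagram_perm unfolding tame_def by simp

lemma sqrt2_le_iff: "sqrt 2 * x \<le> sqrt 2 * y \<longleftrightarrow> x \<le> (y::real)" by simp

text \<open>Without \<open>C\<close>, a turn at \<open>B\<close> is a maximum and pushes
  \<open>gamma_map v\<close> beyond the angle \<open>3 * pi / 4\<close>. Sector 6 would leave only
  the edge between \<open>A\<close> and \<open>B\<close>, so sector 7 remains, and there
  \<open>C\<close> is avoided again.\<close>

lemma tame_no_C_step:
  assumes t: "tame v w" and C: "\<And>n. w n \<noteq> C"
  shows "\<exists>w'. tame (nu 7 (gamma_map v)) w' \<and> (\<forall>n. w' n \<noteq> C)"
proof -
  have v: "vcone v" and np: "\<not> periodic_word w" and "coded v w" using t by (auto simp: tame_def)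
  then obtain a where c: "coding v w a" by (auto simp: coded_def)
  note e = coding_edge0[OF v c]
  define u where "u = gamma_map v"
  define w' where "w' = derived_word w"
  note d = tame_derived[OF t, folded u_def w'_def]
  have "\<exists>n. w n = B"
  proof (rule ccontr)
    assume nB: "\<nexists>n. w n = B"
    have "periodic_word w"
    proof (rule periodic_if_two_letters[of _ A D])
      fix n show "(w n, w (n + 1)) \<in> {(A, D), (D, A)}"
        using e[of n] nB C by (cases "w n") (auto simp: edge0_simps)
    qed
    with np show False ..
  qed
  then obtain n where n: "w n = B" by blast
  have D: "w (n + 1) = D" "w (n - 1) = D"
    using e[of n] e[of "n - 1"] n C[of "n + 1"] C[of "n - 1"] by (auto simp: edge0_def)
  then have "n \<in> sandwiched w" by (simp add: sandwiched_def)
  from turn_sgn(1)[OF v c this] n D(2) have "side_cross B u < 0"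
    by (simp add: turn_sign_simps sgn_if u_def split: if_splits del: side_cross.simps)
  then have x: "Re u + Im u < 0" by (simp add: mult_less_0_iff)
  have y: "Im u \<ge> 0" unfolding u_def by (rule gamma_map_vcone(1)[OF v])
  have tp: "Z = B \<and> (Y = A \<or> Y = D)" if "turn_pair u Y Z" for Y Z
    using that x y by (cases Y; cases Z) (auto simp: turn_pair_def lower_turn_def upper_turn_def zero_less_mult_iff mult_less_0_iff)
  have pairs: "(w' n, w' (n + 1)) \<in> {(A, B), (B, A), (D, B), (B, D)}" for n
    using d(3)[of n] tp by blast
  have "vcone (nu 7 u)"
  proof (rule ccontr)
    assume "\<not> vcone (nu 7 u)"
    then have "- Re u < (1 + sqrt 2) * Im u" using x y by (auto simp: vcone_def nu_simps)
    then have "sqrt 2 * (- Re u) < sqrt 2 * ((1 + sqrt 2) * Im u)" by (rule mult_strict_left_mono) simp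
    then have "(1 + sqrt 2) * (- Re u - Im u) \<le> Im u - Re u" by (simp add: algebra_simps)
    then have "vcone (nu 6 u)" using x y 
      by (simp add: vcone_def nu_simps mult.left_commute[of _ "sqrt 2 / 2"] del: times_divide_eq_left times_divide_eq_right)
    note edges = coded_edge0_nu[OF this _ d(1)]
    have "(w' n, w' (n + 1)) \<in> {(A, B), (B, A)}" for n
      using pairs[of n] edges[of n] by (auto simp: diagram_perm_simps edge0_simps)
    then have "periodic_word w'" by (rule periodic_if_two_letters)
    with d(2) show False ..
  qed
  moreover have nC: "(diagram_perm 7 \<circ> w') n \<noteq> C" for n
    using pairs[of n] by (auto simp: diagram_perm_simps)
  moreover have "no_loop (diagram_perm 7 \<circ> w')" using nC by (simp add: no_loop_def)
  ultimately show ?thesis using tame_nu[OF _ _ d(1,2)] unfolding u_def by fastforce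
qed

text \<open>The map \<open>nu 7\<close> after \<open>gamma_map\<close> is the shear
  \<open>(x, y) -> (x - K * y, y)\<close>. Its orbits leave the cone unless \<open>y = 0\<close>,
  and on the horizontal ray only \<open>D\<close> and \<open>B\<close> can alternate.\<close>

lemma tame_has_C:
  assumes t: "tame v w" shows "\<exists>n. w n = C"
proof (rule ccontr)
  assume "\<nexists>n. w n = C"
  then have C: "\<And>n. w n \<noteq> C" by blast
  define K where "K = 2 * (1 + sqrt 2)"
  have "\<exists>w'. tame (Complex (Re v - real k * (K * Im v)) (Im v)) w' \<and> (\<forall>n. w' n \<noteq> C)" for k
  proof (induction k)
    case 0 then show ?case using t C by auto
  next
    case (Suc k)
    then obtain w' where w': "tame (Complex (Re v - real k * (K * Im v)) (Im v)) w'" "\<And>n. w' n \<noteq> C" by blast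
    have "nu 7 (gamma_map (Complex (Re v - real k * (K * Im v)) (Im v))) = Complex (Re v - real (Suc k) * (K * Im v)) (Im v)"
      by (simp add: nu_simps gamma_map_def K_def algebra_simps)
    then show ?case using tame_no_C_step[OF w'] by simp
  qed
  then have "Re v - real k * (K * Im v) > 0" for k unfolding tame_def vcone_def by (metis complex.sel(1))
  then have "\<not> K * Im v > 0" using reals_Archimedean3[of "K * Im v"] by (meson less_iff_diff_less_0 less_asym)
  moreover have "Im v \<ge> 0" using t by (simp add: tame_def vcone_def)
  moreover have "K > 0" by (simp add: K_def add_pos_pos)
  ultimately have y: "Im v = 0" by (simp add: zero_less_mult_iff)
  have v: "vcone v" and np: "\<not> periodic_word w" and "coded v w" using t by (auto simp: tame_def)
  then obtain a where c: "coding v w a" by (auto simp: coded_def)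
  have "w n \<noteq> A" for n using coding_cross_pos[OF v c, of n] y by auto
  then have "(w n, w (n + 1)) \<in> {(D, B), (B, D)}" for n
    using coding_edge0[OF v c, of n] C[of n] C[of "n + 1"] by (auto simp: edge0_def)
  then have "periodic_word w" by (rule periodic_if_two_letters)
  with np show False ..
qed

lemma tame_step:
  assumes t: "tame v w"
  shows "\<exists>w'. tame (nu 1 (gamma_map v)) w'"
proof -
  have v: "vcone v" and np: "\<not> periodic_word w" and "coded v w" and nl: "no_loop w" using t by (auto simp: tame_def)
  then obtain a where c: "coding v w a" by (auto simp: coded_def)
  note e = coding_edge0[OF v c]
  define u where "u = gamma_map v"
  define w' where "w' = derived_word w"
  note d = tame_derived[OF t, folded u_def w'_def]
  obtain n where n: "w n = C" using tame_has_C[OF t] by blast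
  have nl': "(w k, w (k + 1)) \<noteq> (C, C)" for k using nl by (simp add: no_loop_def)
  have D: "w (n + 1) = B" "w (n - 1) = B"
    using e[of n] e[of "n - 1"] n nl'[of n] nl'[of "n - 1"] by (auto simp: edge0_def)
  then have "n \<in> sandwiched w" by (simp add: sandwiched_def)
  from turn_sgn(1)[OF v c this] n D(2) have x: "Re u > 0"
    by (simp add: turn_sign_simps sgn_if u_def split: if_splits)
  note g = gamma_map_vcone[OF v, folded u_def]
  have y: "Im u > 0" using g x by (metis order_le_less less_asym)
  show ?thesis
  proof (cases "Im u \<le> Re u")
    case True
    have "turn_pair u Y Z \<Longrightarrow> (Y, Z) \<in> {(A, D), (A, C), (B, C)}" for Y Z
      using x y True by (cases Y; cases Z) (auto simp: turn_pair_def lower_turn_def upper_turn_def zero_less_mult_iff mult_less_0_iff)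
    then have pairs: "(w' n, w' (n + 1)) \<in> {(A, D), (A, C), (B, C), (D, A), (C, A), (C, B)}" for n
      using d(3)[of n] by blast
    have "sqrt 2 * Re u \<le> sqrt 2 * ((1 + sqrt 2) * Im u)" using g(3) by simp
    then have "(1 + sqrt 2) * (Re u - Im u) \<le> Re u + Im u" by (simp add: algebra_simps)
    then have "vcone (nu 1 u)" using x y True
      by (simp add: vcone_def nu_simps mult.left_commute[of _ "sqrt 2 / 2"] del: times_divide_eq_left times_divide_eq_right)
    moreover have "no_loop (diagram_perm 1 \<circ> w')"
      unfolding no_loop_def
    proof
      fix n show "((diagram_perm 1 \<circ> w') n, (diagram_perm 1 \<circ> w') (n + 1)) \<noteq> (C, C)"
        using pairs[of n] by (auto simp: diagram_perm_simps)
    qed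
    ultimately show ?thesis using tame_nu[of 1, OF _ _ d(1,2)] unfolding u_def by auto
  next
    case False
    have "turn_pair u Y Z \<Longrightarrow> (Y, Z) \<in> {(A, C), (B, C), (D, C)}" for Y Z
      using x y False by (cases Y; cases Z) (auto simp: turn_pair_def lower_turn_def upper_turn_def zero_less_mult_iff mult_less_0_iff)
    then have pairs: "(w' n, w' (n + 1)) \<in> {(A, C), (B, C), (D, C), (C, A), (C, B), (C, D)}" for n
      using d(3)[of n] by blast
    have "\<not> vcone (nu 2 u)"
    proof
      assume v2: "vcone (nu 2 u)"
      note edges = coded_edge0_nu[OF v2 _ d(1)]
      have p: "(w' n, w' (n + 1)) \<in> {(A, C), (C, A), (D, C), (C, D)}" for n
        using pairs[of n] edges[of n] by (auto simp: diagram_perm_simps edge0_simps)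
      have nC: "(diagram_perm 2 \<circ> w') n \<noteq> C" for n
        using p[of n] by (auto simp: diagram_perm_simps)
      then have "no_loop (diagram_perm 2 \<circ> w')" by (simp add: no_loop_def)
      then show False using tame_has_C[OF tame_nu[OF v2 _ d(1,2)]] nC by auto
    qed
    then have "\<not> (1 + sqrt 2) * (Im u - Re u) \<le> Re u + Im u" using x y False
      by (simp add: vcone_def nu_simps mult.left_commute[of _ "sqrt 2 / 2"] del: times_divide_eq_left times_divide_eq_right)
    then have "sqrt 2 * ((1 + sqrt 2) * Re u) \<le> sqrt 2 * Im u" by (simp add: algebra_simps)
    then have "(1 + sqrt 2) * Re u \<le> Im u" unfolding sqrt2_le_iff .
    then have "vcone (nu 3 u)" using x y by (simp add: vcone_def nu_simps)
    note edges = coded_edge0_nu[OF this _ d(1)]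
    have "(w' n, w' (n + 1)) \<in> {(D, C), (C, D)}" for n
      using pairs[of n] edges[of n] by (auto simp: diagram_perm_simps edge0_simps)
    then have "periodic_word w'" by (rule periodic_if_two_letters)
    with d(2) show ?thesis ..
  qed
qed

text \<open>The map \<open>nu 1\<close> after \<open>gamma_map\<close> is a shear fixing the ray of
  angle \<open>pi / 8\<close>: it keeps \<open>p\<close> and lowers \<open>y\<close> by
  \<open>sqrt 2 / 2 * p\<close>. Since \<open>y\<close> stays non-negative,
  \<open>p = 0\<close>.\<close>

lemma not_tame: "\<not> tame v w"
proof
  assume t: "tame v w"
  define p where "p = Re v - (1 + sqrt 2) * Im v"
  define y where "y k = Im v - real k * (sqrt 2 / 2 * p)" for k
  have it: "\<exists>w'. tame (Complex (p + (1 + sqrt 2) * y k) (y k)) w'" for k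
  proof (induction k)
    case 0
    have "Complex (p + (1 + sqrt 2) * y 0) (y 0) = v" by (simp add: complex_eq_iff p_def y_def)
    then show ?case using t by auto
  next
    case (Suc k)
    then obtain w' where w': "tame (Complex (p + (1 + sqrt 2) * y k) (y k)) w'" by blast
    have "nu 1 (gamma_map (Complex (p + (1 + sqrt 2) * y k) (y k))) =
        Complex (p + (1 + sqrt 2) * (y k - sqrt 2 / 2 * p)) (y k - sqrt 2 / 2 * p)"
      by (simp add: nu_simps gamma_map_def field_simps)
    moreover have "y (Suc k) = y k - sqrt 2 / 2 * p" by (simp add: y_def algebra_simps)
    ultimately show ?case using tame_step[OF w'] by metis
  qed
  have "y k \<ge> 0" for k using it[of k] by (auto simp: tame_def vcone_def)
  then have "\<not> sqrt 2 / 2 * p > 0" using reals_Archimedean3[of "sqrt 2 / 2 * p"] unfolding y_def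
    by (meson less_iff_diff_less_0 not_less)
  moreover have "p \<ge> 0" using t by (simp add: tame_def vcone_def p_def)
  ultimately have p: "p = 0" by (simp add: zero_less_mult_iff)
  have v: "vcone v" and np: "\<not> periodic_word w" and "coded v w" and nl: "no_loop w" using t by (auto simp: tame_def)
  then obtain a where c: "coding v w a" by (auto simp: coded_def)
  have x: "Re v = (1 + sqrt 2) * Im v" using p by (simp add: p_def)
  \<comment> \<open>On the ray of angle \<open>pi / 8\<close> the strict inequality required for a
    step between \<open>D\<close> and \<open>B\<close> degenerates to an equality. The walk is thus
    confined to one of the edges \<open>A - D\<close> and \<open>B - C\<close>.\<close>
  have "side_cross D v + side_cross B v = - ((1 + sqrt 2) * side_dot D v + (1 + sqrt 2) * side_dot B v)"
    by (simp add: x field_simps)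
  then have noDB: "(w n, w (n + 1)) \<notin> {(D, B), (B, D)}" for n
    using coding_step_bound[OF v c, of n] coding_step_bound(1)[OF v c, of "n + 1"]
    by (auto simp del: side_cross.simps side_dot.simps)
  have noCC: "(w n, w (n + 1)) \<noteq> (C, C)" for n using nl by (simp add: no_loop_def)
  have ed: "(w n, w (n + 1)) \<in> {(A, D), (D, A), (B, C), (C, B)}" for n
    using coding_edge0[OF v c, of n] noDB[of n] noCC[of n] unfolding edge0_def by blast
  have "periodic_word w"
  proof (rule periodic_if_step2)
    fix n show "w (n + 2) = w n" using ed[of n] ed[of "n + 1"] by (auto simp: add.assoc)
  qed
  with np show False ..
qed

section \<open>Edges common to two diagrams\<close>

definition diagram_edge :: "nat \<Rightarrow> letter \<Rightarrow> letter \<Rightarrow> bool" where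
  "diagram_edge i X Y \<longleftrightarrow> edge0 (diagram_perm i X) (diagram_perm i Y)"

lemma admissible_iff: "admissible i w \<longleftrightarrow> (\<forall>n. diagram_edge i (w n) (w (n + 1)))"
  by (simp add: admissible_def admissible0_iff diagram_edge_def)

lemma diagram_edge_simps:
  "diagram_edge 0 X Y \<longleftrightarrow> (X, Y) \<in> {(A, D), (D, A), (D, B), (B, D), (B, C), (C, B), (C, C)}"
  "diagram_edge 1 X Y \<longleftrightarrow> (X, Y) \<in> {(D, A), (A, D), (A, C), (C, A), (C, B), (B, C), (B, B)}"
  "diagram_edge 2 X Y \<longleftrightarrow> (X, Y) \<in> {(D, C), (C, D), (C, A), (A, C), (A, B), (B, A), (B, B)}"
  "diagram_edge 3 X Y \<longleftrightarrow> (X, Y) \<in> {(C, D), (D, C), (D, B), (B, D), (B, A), (A, B), (A, A)}"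
  "diagram_edge 4 X Y \<longleftrightarrow> (X, Y) \<in> {(C, B), (B, C), (B, D), (D, B), (D, A), (A, D), (A, A)}"
  "diagram_edge 5 X Y \<longleftrightarrow> (X, Y) \<in> {(B, C), (C, B), (C, A), (A, C), (A, D), (D, A), (D, D)}"
  "diagram_edge 6 X Y \<longleftrightarrow> (X, Y) \<in> {(B, A), (A, B), (A, C), (C, A), (C, D), (D, C), (D, D)}"
  "diagram_edge 7 X Y \<longleftrightarrow> (X, Y) \<in> {(A, B), (B, A), (B, D), (D, B), (D, C), (C, D), (C, C)}"
  by (cases X; cases Y; simp add: diagram_edge_def diagram_perm_simps edge0_def)+

text \<open>Other pairs of diagrams share too few edges for two consecutive steps that do not turn
  back. Diagrams \<open>i\<close> and \<open>i + 4\<close> share their whole path and differ only in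
  which end carries the loop.\<close>

lemma diagram_edge_common:
  assumes "i \<le> 7" "j \<le> 7" "i < j" "diagram_edge i X Y" "diagram_edge j X Y" "diagram_edge i Y Z" "diagram_edge j Y Z"
  shows "X = Z \<or> j = i + 4"
  by (rule sector_index_cases[OF assms(1)]; rule sector_index_cases[OF assms(2)];
      insert assms(3-7); simp add: diagram_edge_simps; auto)

text \<open>By \<open>not_tame\<close> the word uses the loop of diagram \<open>i\<close>. A second
  diagram would have to be the one with the loop at the opposite end, which does not allow this
  repeated letter.\<close>

lemma diagram_of_sector:
  assumes i: "i \<le> 7" and s: "\<theta> \<in> sector i" and c: "coded (cis \<theta>) w" and np: "\<not> periodic_word w"
  shows "diagram_of w = i"
  unfolding diagram_of_def
proof (rule the_equality)
  show ai: "i \<le> 7 \<and> admissible i w" using i admissible_sector[OF i s c] by blast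
  fix j assume j: "j \<le> 7 \<and> admissible j w"
  show "j = i"
  proof (rule ccontr)
    assume ne: "j \<noteq> i"
    have e: "diagram_edge i (w n) (w (n + 1))" "diagram_edge j (w n) (w (n + 1))" for n
      using ai j by (auto simp: admissible_iff)
    have nl: "\<not> no_loop (diagram_perm i \<circ> w)"
      using not_tame[of "nu i (cis \<theta>)"] tame_nu[OF vcone_nu[OF s] i c np] by blast
    have "w (n + 2) = w n" if "i < j \<and> j \<noteq> i + 4 \<or> j < i \<and> i \<noteq> j + 4" for n
      using that diagram_edge_common[of i j "w n" "w (n + 1)" "w (n + 1 + 1)"]
        diagram_edge_common[of j i "w n" "w (n + 1)" "w (n + 1 + 1)"] i j e[of n] e[of "n + 1"]
      by (auto simp: add.assoc)
    then have "j = i + 4 \<or> i = j + 4" using np periodic_if_step2[of w] ne by (meson nat_neq_iff)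
    moreover obtain n where n: "diagram_perm i (w n) = C" "diagram_perm i (w (n + 1)) = C"
      using nl by (auto simp: no_loop_def)
    have "w n = w (n + 1)" using n injD[OF inj_diagram_perm[OF i]] by metis
    then have "diagram_edge j (w n) (w n)" using e(2)[of n] by simp
    ultimately show False
      by (rule_tac sector_index_cases[OF i]; insert n(1) j; cases "w n";
          auto simp: diagram_edge_def diagram_perm_simps edge0_def simp flip: One_nat_def)
  qed
qed

subsection \<open>Geometry of the octagon\<close>

lemma cos_pi_8: "cos (pi / 8) = (1 + sqrt 2) * sin (pi / 8)"
proof -
  have "pi / 8 + pi / 4 = pi / 2 - pi / 8" by simp
  then have "cos (pi / 8) - (1 + sqrt 2) * sin (pi / 8) = 0" unfolding cos_sin_diff by simp
  then show ?thesis by simp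
qed

lemma oct_vertex_1: "oct_vertex 1 = Complex (- 1 / 2) ((1 + sqrt 2) / 2)"
proof -
  have s: "sin (pi / 8) > 0" by (rule sin_gt_zero) auto
  have "5 * pi / 8 = pi / 2 + pi / 8" by simp
  then have "cos (5 * pi / 8) = - sin (pi / 8)" "sin (5 * pi / 8) = cos (pi / 8)"
    by (simp_all only: cos_add sin_add) simp_all
  then show ?thesis using s by (simp add: oct_vertex_def complex_eq_iff cos_pi_8)
qed

lemma oct_vertex_Suc:
  "oct_vertex (k + 1) = Complex (sqrt 2 / 2 * (Re (oct_vertex k) + Im (oct_vertex k)))
     (sqrt 2 / 2 * (Im (oct_vertex k) - Re (oct_vertex k)))"
proof -
  have e: "5 * pi / 8 - (real (k + 1) - 1) * (pi / 4) = (5 * pi / 8 - (real k - 1) * (pi / 4)) + (- (pi / 4))"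
    by (simp add: field_simps)
  have "oct_vertex (k + 1) = oct_vertex k * cis (- (pi / 4))"
    unfolding oct_vertex_def e cis_mult[symmetric] by (simp only: mult.assoc)
  then show ?thesis by (simp add: complex_eq_iff cos_45 sin_45 field_simps)
qed

lemma oct_vertices:
  "oct_vertex 1 = Complex (- 1 / 2) ((1 + sqrt 2) / 2)"
  "oct_vertex 2 = Complex (1 / 2) ((1 + sqrt 2) / 2)"
  "oct_vertex 3 = Complex ((1 + sqrt 2) / 2) (1 / 2)"
  "oct_vertex 4 = Complex ((1 + sqrt 2) / 2) (- 1 / 2)"
  "oct_vertex 5 = Complex (1 / 2) (- (1 + sqrt 2) / 2)"
  "oct_vertex 6 = Complex (- 1 / 2) (- (1 + sqrt 2) / 2)"
  "oct_vertex 7 = Complex (- (1 + sqrt 2) / 2) (- 1 / 2)"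
  "oct_vertex 8 = Complex (- (1 + sqrt 2) / 2) (1 / 2)"
proof -
  show 1: "oct_vertex 1 = Complex (- 1 / 2) ((1 + sqrt 2) / 2)" by (rule oct_vertex_1)
  show 2: "oct_vertex 2 = Complex (1 / 2) ((1 + sqrt 2) / 2)"
    using oct_vertex_Suc[of 1] unfolding 1 by (simp add: field_simps)
  show 3: "oct_vertex 3 = Complex ((1 + sqrt 2) / 2) (1 / 2)"
    using oct_vertex_Suc[of 2] unfolding 2 by (simp add: field_simps)
  show 4: "oct_vertex 4 = Complex ((1 + sqrt 2) / 2) (- 1 / 2)"
    using oct_vertex_Suc[of 3] unfolding 3 by (simp add: field_simps)
  show 5: "oct_vertex 5 = Complex (1 / 2) (- (1 + sqrt 2) / 2)"
    using oct_vertex_Suc[of 4] unfolding 4 by (simp add: field_simps)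
  show 6: "oct_vertex 6 = Complex (- 1 / 2) (- (1 + sqrt 2) / 2)"
    using oct_vertex_Suc[of 5] unfolding 5 by (simp add: field_simps)
  show 7: "oct_vertex 7 = Complex (- (1 + sqrt 2) / 2) (- 1 / 2)"
    using oct_vertex_Suc[of 6] unfolding 6 by (simp add: field_simps)
  show 8: "oct_vertex 8 = Complex (- (1 + sqrt 2) / 2) (1 / 2)"
    using oct_vertex_Suc[of 7] unfolding 7 by (simp add: field_simps)
qed

lemma oct_vertex_opposite: "oct_vertex (k + 4) = - oct_vertex k"
proof -
  have e: "5 * pi / 8 - (real (k + 4) - 1) * (pi / 4) = (5 * pi / 8 - (real k - 1) * (pi / 4)) + (- pi)"
    by (simp add: field_simps)
  have m: "cis (- pi) = - 1" by (simp add: complex_eq_iff)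
  show ?thesis unfolding oct_vertex_def e cis_mult[symmetric] m by simp
qed

lemma to_opposite_eq: "to_opposite k = - (oct_vertex k + oct_vertex (k + 1))"
  using oct_vertex_opposite[of "k + 1"] by (simp add: to_opposite_def add.assoc)

text \<open>Sides \<open>k\<close> and \<open>k + 4\<close> share a label and hence a frame; the
  sign tells on which side of the centre they lie.\<close>

definition side_sign :: "nat \<Rightarrow> real" where
  "side_sign k = (if k \<le> 4 then 1 else - 1)"

lemma side_index_cases:
  assumes "k \<in> {1..(8::nat)}"
  obtains "k = 1" | "k = 2" | "k = 3" | "k = 4" | "k = 5" | "k = 6" | "k = 7" | "k = 8"
proof -
  have "k - 1 \<le> 7" using assms by auto
  then show ?thesis using assms that by (rule_tac sector_index_cases[of "k - 1"]) auto
qed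

lemma side_label_simps:
  "side_label 1 = A" "side_label 2 = B" "side_label 3 = C" "side_label 4 = D"
  "side_label 5 = A" "side_label 6 = B" "side_label 7 = C" "side_label 8 = D"
  by (simp_all add: side_label_def One_nat_def)

lemma side_sign_simps:
  "side_sign 1 = 1" "side_sign 2 = 1" "side_sign 3 = 1" "side_sign 4 = 1"
  "side_sign 5 = - 1" "side_sign 6 = - 1" "side_sign 7 = - 1" "side_sign 8 = - 1"
  by (simp_all add: side_sign_def)

lemma oct_vertex_9: "oct_vertex 9 = oct_vertex 1"
  using oct_vertex_opposite[of 5] oct_vertex_opposite[of 1] by simp

lemma side_frame:
  assumes "k \<in> {1..8}"
  shows "side_cross (side_label k) (oct_vertex k) = side_sign k * (1 + sqrt 2) / 2"
    "side_cross (side_label k) (oct_vertex (k + 1)) = side_sign k * (1 + sqrt 2) / 2"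
    "side_dot (side_label k) (oct_vertex k) = - side_sign k / 2"
    "side_dot (side_label k) (oct_vertex (k + 1)) = side_sign k / 2"
proof -
  have n: "1 + 1 = (2::nat)" "2 + 1 = (3::nat)" "3 + 1 = (4::nat)" "4 + 1 = (5::nat)"
    "5 + 1 = (6::nat)" "6 + 1 = (7::nat)" "7 + 1 = (8::nat)" "8 + 1 = (9::nat)" by simp_all
  note simps = side_label_simps side_sign_simps n oct_vertices oct_vertex_9
    side_cross.simps side_dot.simps complex.sel
  show "side_cross (side_label k) (oct_vertex k) = side_sign k * (1 + sqrt 2) / 2"
    by (rule side_index_cases[OF assms]; simp only: simps; simp add: field_simps)
  show "side_cross (side_label k) (oct_vertex (k + 1)) = side_sign k * (1 + sqrt 2) / 2"
    by (rule side_index_cases[OF assms]; simp only: simps; simp add: field_simps)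
  show "side_dot (side_label k) (oct_vertex k) = - side_sign k / 2"
    by (rule side_index_cases[OF assms]; simp only: simps; simp add: field_simps)
  show "side_dot (side_label k) (oct_vertex (k + 1)) = side_sign k / 2"
    by (rule side_index_cases[OF assms]; simp only: simps; simp add: field_simps)
qed

lemma side_linear:
  "side_cross X (u + v) = side_cross X u + side_cross X v" "side_cross X (- v) = - side_cross X v"
  "side_dot X (u + v) = side_dot X u + side_dot X v" "side_dot X (- v) = - side_dot X v"
  by (cases X; simp add: field_simps; fail)+

lemma side_scaleR:
  "side_cross X (r *\<^sub>R v) = r * side_cross X v" "side_dot X (r *\<^sub>R v) = r * side_dot X v"
  by (cases X; simp add: algebra_simps)+

lemma to_opposite_frame:
  assumes "k \<in> {1..8}"
  shows "side_cross (side_label k) (to_opposite k) = - side_sign k * (1 + sqrt 2)"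
    "side_dot (side_label k) (to_opposite k) = 0"
  unfolding to_opposite_eq side_linear side_frame[OF assms] by (simp_all add: field_simps)

lemma oct_side_frame:
  assumes "k \<in> {1..8}" "z \<in> oct_side k"
  shows "side_cross (side_label k) z = side_sign k * (1 + sqrt 2) / 2"
    "\<bar>side_dot (side_label k) z\<bar> < 1 / 2"
proof -
  obtain u where u: "0 < u" "u < 1" "z = (1 - u) *\<^sub>R oct_vertex k + u *\<^sub>R oct_vertex (k + 1)"
    using assms(2) by (auto simp: oct_side_def in_segment)
  show "side_cross (side_label k) z = side_sign k * (1 + sqrt 2) / 2"
    unfolding u(3) side_linear side_scaleR side_frame[OF assms(1)] by (simp add: field_simps)
  have "side_dot (side_label k) z = side_sign k * (u - 1 / 2)"
    unfolding u(3) side_linear side_scaleR side_frame[OF assms(1)] by (simp add: field_simps)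
  moreover have "\<bar>side_sign k\<bar> = 1" by (simp add: side_sign_def)
  moreover have "\<bar>u - 1 / 2\<bar> < 1 / 2" using u(1,2) unfolding abs_less_iff by linarith
  ultimately show "\<bar>side_dot (side_label k) z\<bar> < 1 / 2" by (simp only: abs_mult mult_1_left)
qed

text \<open>Frames of distinct labels differ by a rotation through a multiple of
  \<open>pi / 4\<close>. The bound serves to show that a point of one side cannot lie on a side with
  another label.\<close>

lemma side_cross_bound:
  assumes "X \<noteq> Y"
  shows "\<bar>side_cross Y z\<bar> = \<bar>side_dot X z\<bar> \<or>
    \<bar>side_cross Y z\<bar> \<le> sqrt 2 / 2 * (\<bar>side_cross X z\<bar> + \<bar>side_dot X z\<bar>)"
proof -
  have *: "\<bar>sqrt 2 / 2 * (a + b)\<bar> \<le> sqrt 2 / 2 * (\<bar>a\<bar> + \<bar>b\<bar>)"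
    "\<bar>sqrt 2 / 2 * (a - b)\<bar> \<le> sqrt 2 / 2 * (\<bar>a\<bar> + \<bar>b\<bar>)" for a b :: real
    unfolding abs_mult by (auto intro!: mult_left_mono abs_triangle_ineq abs_triangle_ineq4)
  consider "side_cross Y z = side_dot X z" | "side_cross Y z = - side_dot X z"
    | "side_cross Y z = sqrt 2 / 2 * (side_cross X z + side_dot X z)"
    | "side_cross Y z = sqrt 2 / 2 * (side_cross X z - side_dot X z)"
    | "side_cross Y z = - (sqrt 2 / 2 * (side_cross X z + side_dot X z))"
    | "side_cross Y z = - (sqrt 2 / 2 * (side_cross X z - side_dot X z))"
    using assms by (cases X; cases Y) (simp_all add: field_simps)
  then show ?thesis by cases (simp_all only: abs_minus_cancel * simp_thms)
qed

lemma oct_side_label_unique: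
  assumes "j \<in> {1..8}" "k \<in> {1..8}" "z \<in> oct_side j" "z \<in> oct_side k"
  shows "side_label j = side_label k"
proof (rule ccontr)
  assume ne: "side_label j \<noteq> side_label k"
  define X Y where "X = side_label j" and "Y = side_label k"
  have s: "\<bar>side_sign i * (1 + sqrt 2) / 2\<bar> = (1 + sqrt 2) / 2" for i
    by (simp add: side_sign_def abs_mult)
  have c: "\<bar>side_cross X z\<bar> = (1 + sqrt 2) / 2" "\<bar>side_cross Y z\<bar> = (1 + sqrt 2) / 2"
    unfolding X_def Y_def oct_side_frame(1)[OF assms(1,3)] oct_side_frame(1)[OF assms(2,4)] by (rule s)+
  have d: "\<bar>side_dot X z\<bar> < 1 / 2"
    using oct_side_frame(2)[OF assms(1,3)] by (simp add: X_def)
  then have "sqrt 2 / 2 * (\<bar>side_cross X z\<bar> + \<bar>side_dot X z\<bar>) < sqrt 2 / 2 * ((1 + sqrt 2) / 2 + 1 / 2)"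
    unfolding c by simp
  also have "\<dots> = (1 + sqrt 2) / 2" by (simp add: field_simps)
  finally show False using side_cross_bound[of X Y z] ne c d sqrt2_bounds unfolding X_def[symmetric] Y_def[symmetric] by argo
qed

lemma interior_octagon_halfspace:
  assumes "k \<in> {1..8}"
  shows "interior octagon \<subseteq> {z. side_sign k * side_cross (side_label k) z < (1 + sqrt 2) / 2}"
proof -
  \<comment> \<open>The outward unit normal of side \<open>k\<close>, turning the coordinate into an
    inner product to which the half-space lemmas apply.\<close>
  define c where "c = complex_of_real (side_sign k) * (case side_label k of A \<Rightarrow> \<i> | B \<Rightarrow> cis (pi / 4) | C \<Rightarrow> 1 | D \<Rightarrow> cis (- (pi / 4)))"
  have c: "side_sign k * side_cross (side_label k) z = c \<bullet> z" for z
    by (cases "side_label k") (simp_all add: c_def inner_complex_def cos_45 sin_45 field_simps)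
  have c0: "c \<noteq> 0" by (cases "side_label k") (simp_all add: c_def side_sign_def)
  have "oct_vertex j \<in> {z. c \<bullet> z \<le> (1 + sqrt 2) / 2}" if "j \<in> {1..8}" for j
    unfolding c[symmetric] mem_Collect_eq
    by (rule_tac side_index_cases[OF assms]; rule_tac side_index_cases[OF that]; 
        insert sqrt2_bounds; simp only: side_label_simps side_sign_simps oct_vertices; simp add: field_simps)
  then have "octagon \<subseteq> {z. c \<bullet> z \<le> (1 + sqrt 2) / 2}"
    unfolding octagon_def by (intro hull_minimal convex_halfspace_le image_subsetI)
  then show "interior octagon \<subseteq> {z. side_sign k * side_cross (side_label k) z < (1 + sqrt 2) / 2}"
    using interior_mono interior_halfspace_le[OF c0] unfolding c by metis
qed

lemma oct_side_not_interior:
  assumes "k \<in> {1..8}" "z \<in> oct_side k" shows "z \<notin> interior octagon"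
proof
  assume "z \<in> interior octagon"
  then have "side_sign k * side_cross (side_label k) z < (1 + sqrt 2) / 2"
    using interior_octagon_halfspace[OF assms(1)] by blast
  then show False unfolding oct_side_frame(1)[OF assms] by (simp add: side_sign_def split: if_splits)
qed

section \<open>From trajectories to codings\<close>

text \<open>Subtracting the uniform motion leaves a function that is locally constant between two
  hits, hence constant there by connectedness; the one-sided formulas at both ends then compare its
  values.\<close>

lemma trajectory_step:
  fixes t :: "int \<Rightarrow> real"
  assumes t: "strict_mono t" "range t = {s. \<exists>k\<in>{1..8}. \<tau> s \<in> oct_side k}"
    and r: "r > 0"
    and inside: "\<And>s. s \<notin> range t \<Longrightarrow> \<tau> s \<in> interior octagon \<and>
        (\<exists>\<epsilon>>0. \<forall>u. \<bar>u\<bar> < \<epsilon> \<longrightarrow> \<tau> (s + u) = \<tau> s + of_real (u * r) * v)"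
    and enter: "\<epsilon> > 0" "\<And>u. 0 \<le> u \<Longrightarrow> u < \<epsilon> \<Longrightarrow> \<tau> (t n + u) = \<tau> (t n) + of_real (u * r) * v"
    and leave: "\<epsilon>' > 0" "\<And>u. - \<epsilon>' < u \<Longrightarrow> u < 0 \<Longrightarrow>
        \<tau> (t (n + 1) + u) = \<tau> (t (n + 1)) + to_opposite k + of_real (u * r) * v"
  shows "\<tau> (t (n + 1)) + to_opposite k = \<tau> (t n) + of_real ((t (n + 1) - t n) * r) * v"
    and "\<exists>u>0. \<tau> (t n) + of_real u * v \<in> interior octagon"
proof -
  define g where "g s = \<tau> s - of_real (s * r) * v" for s
  define I where "I = {t n <..< t (n + 1)}"
  have less: "t n < t (n + 1)" using t(1) by (simp add: strict_mono_def)
  have out: "s \<notin> range t" if "s \<in> I" for s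
    using strict_mono_int_gap[OF t(1) refl, of n s] that by (auto simp: I_def)
  have loc: "\<forall>s\<in>I. eventually (\<lambda>s'. g s = g s') (at s within I)"
  proof
    fix s assume "s \<in> I"
    then obtain \<epsilon> where e: "\<epsilon> > 0" "\<And>u. \<bar>u\<bar> < \<epsilon> \<Longrightarrow> \<tau> (s + u) = \<tau> s + of_real (u * r) * v"
      using inside[OF out] by blast
    show "eventually (\<lambda>s'. g s = g s') (at s within I)"
      unfolding eventually_at
    proof (intro exI[of _ \<epsilon>] conjI ballI impI)
      fix s' assume "s' \<noteq> s \<and> dist s' s < \<epsilon>"
      then show "g s = g s'" using e(2)[of "s' - s"] by (simp add: g_def dist_real_def algebra_simps)
    qed (rule e(1))
  qed
  have const: "g s = g s'" if "s \<in> I" "s' \<in> I" for s s'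
    by (rule connected_local_const[OF _ that loc]) (simp add: I_def)
  define m where "m = min (min \<epsilon> \<epsilon>') (t (n + 1) - t n) / 2"
  have m: "m > 0" "m < \<epsilon>" "m < \<epsilon>'" "m < t (n + 1) - t n" using enter(1) leave(1) less by (auto simp: m_def)
  have "t n + m \<in> I" "t (n + 1) - m \<in> I" using m by (auto simp: I_def)
  from const[OF this]
  have "\<tau> (t n + m) - of_real ((t n + m) * r) * v = \<tau> (t (n + 1) - m) - of_real ((t (n + 1) - m) * r) * v"
    by (simp add: g_def)
  moreover have "\<tau> (t n + m) = \<tau> (t n) + of_real (m * r) * v" using enter(2)[of m] m by simp
  moreover have "\<tau> (t (n + 1) - m) = \<tau> (t (n + 1)) + to_opposite k + of_real (- m * r) * v"
    using leave(2)[of "- m"] m by simp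
  ultimately show "\<tau> (t (n + 1)) + to_opposite k = \<tau> (t n) + of_real ((t (n + 1) - t n) * r) * v"
    by (simp add: algebra_simps)
  show "\<exists>u>0. \<tau> (t n) + of_real u * v \<in> interior octagon"
    using \<open>\<tau> (t n + m) = \<tau> (t n) + of_real (m * r) * v\<close> inside[OF out[OF \<open>t n + m \<in> I\<close>]] m(1) r
    by (intro exI[of _ "m * r"]) simp
qed

lemma cvec_cross_frame: "cvec_cross v z = side_dot X v * side_cross X z - side_cross X v * side_dot X z"
  by (cases X) (simp_all add: cvec_cross_def field_simps)

lemma coded_trajectory:
  assumes traj: "linear_trajectory \<theta> \<tau>" and cut: "cutting_sequence \<tau> w"
  shows "coded (cis \<theta>) w"
proof -
  define v where "v = cis \<theta>"
  obtain r where r: "r > 0" and tr: "\<And>s. (\<tau> s \<in> interior octagon \<and>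
        (\<exists>\<epsilon>>0. \<forall>u. \<bar>u\<bar> < \<epsilon> \<longrightarrow> \<tau> (s + u) = \<tau> s + of_real (u * r) * v)) \<or>
     (\<exists>k\<in>{1..8}. \<tau> s \<in> oct_side k \<and>
        (\<exists>\<epsilon>>0. (\<forall>u. 0 \<le> u \<and> u < \<epsilon> \<longrightarrow> \<tau> (s + u) = \<tau> s + of_real (u * r) * v) \<and>
               (\<forall>u. - \<epsilon> < u \<and> u < 0 \<longrightarrow>
                  \<tau> (s + u) = \<tau> s + to_opposite k + of_real (u * r) * v)))"
    using traj unfolding linear_trajectory_def v_def by blast
  obtain t where t: "strict_mono t" "range t = {s. \<exists>k\<in>{1..8}. \<tau> s \<in> oct_side k}"
    and lab: "\<And>n. \<exists>k\<in>{1..8}. \<tau> (t n) \<in> oct_side k \<and> w n = side_label k"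
    using cut unfolding cutting_sequence_def by blast
  have inside: "\<tau> s \<in> interior octagon \<and> (\<exists>\<epsilon>>0. \<forall>u. \<bar>u\<bar> < \<epsilon> \<longrightarrow> \<tau> (s + u) = \<tau> s + of_real (u * r) * v)"
    if "s \<notin> range t" for s using tr[of s] that unfolding t(2) by blast
  have "\<exists>k \<epsilon>. k \<in> {1..8} \<and> \<tau> (t n) \<in> oct_side k \<and> w n = side_label k \<and> \<epsilon> > 0 \<and>
      (\<forall>u. 0 \<le> u \<and> u < \<epsilon> \<longrightarrow> \<tau> (t n + u) = \<tau> (t n) + of_real (u * r) * v) \<and>
      (\<forall>u. - \<epsilon> < u \<and> u < 0 \<longrightarrow> \<tau> (t n + u) = \<tau> (t n) + to_opposite k + of_real (u * r) * v)" for n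
  proof -
    \<comment> \<open>The two definitions may select different sides at the same hit;
      \<open>oct_side_label_unique\<close> shows that the label is the same.\<close>
    obtain j where j: "j \<in> {1..8}" "\<tau> (t n) \<in> oct_side j" "w n = side_label j" using lab by blast
    have "\<tau> (t n) \<notin> interior octagon" by (rule oct_side_not_interior[OF j(1,2)])
    then obtain k \<epsilon> where k: "k \<in> {1..8}" "\<tau> (t n) \<in> oct_side k" "\<epsilon> > 0"
      "\<forall>u. 0 \<le> u \<and> u < \<epsilon> \<longrightarrow> \<tau> (t n + u) = \<tau> (t n) + of_real (u * r) * v"
      "\<forall>u. - \<epsilon> < u \<and> u < 0 \<longrightarrow> \<tau> (t n + u) = \<tau> (t n) + to_opposite k + of_real (u * r) * v"
      using tr[of "t n"] by blast
    moreover have "w n = side_label k" using oct_side_label_unique[OF j(1) k(1) j(2) k(2)] j(3) by simp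
    ultimately show ?thesis by blast
  qed
  then obtain k \<epsilon> where k: "\<And>n. k n \<in> {1..8}" "\<And>n. \<tau> (t n) \<in> oct_side (k n)" "\<And>n. w n = side_label (k n)"
    and eps: "\<And>n. \<epsilon> n > 0"
    and enter: "\<And>n u. 0 \<le> u \<Longrightarrow> u < \<epsilon> n \<Longrightarrow> \<tau> (t n + u) = \<tau> (t n) + of_real (u * r) * v"
    and leave: "\<And>n u. - \<epsilon> n < u \<Longrightarrow> u < 0 \<Longrightarrow> \<tau> (t n + u) = \<tau> (t n) + to_opposite (k n) + of_real (u * r) * v"
    by metis
  note step = trajectory_step[OF t r inside eps enter eps leave]
  note frame = oct_side_frame[OF k(1,2), folded k(3)]
  \<comment> \<open>After re-entry the trajectory moves into the interior, so \<open>v\<close>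
    points inwards at side \<open>k n\<close>.\<close>
  have sgn: "sgn (side_cross (w n) v) = - side_sign (k n)" for n
  proof -
    obtain u where u: "u > 0" "\<tau> (t n) + of_real u * v \<in> interior octagon" using step(2) by blast
    then have "side_sign (k n) * side_cross (w n) (\<tau> (t n) + of_real u * v) < (1 + sqrt 2) / 2"
      using interior_octagon_halfspace[OF k(1)] k(3) by auto
    moreover have "side_sign (k n) * side_cross (w n) (\<tau> (t n) + of_real u * v) =
        (1 + sqrt 2) / 2 + u * (side_sign (k n) * side_cross (w n) v)"
      unfolding side_linear side_scale frame(1) by (simp add: side_sign_def distrib_left)
    ultimately have "u * (side_sign (k n) * side_cross (w n) v) < 0" by linarith
    then have "side_sign (k n) * side_cross (w n) v < 0" using u(1) by (metis mult_less_0_iff less_asym)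
    then show ?thesis by (simp add: side_sign_def sgn_if split: if_splits)
  qed
  define a where "a n = - 2 * (side_cross (w n) v * side_dot (w n) (\<tau> (t n)))" for n
  \<comment> \<open>Twice the cross product of \<open>v\<close> with the position: \<open>cr\<close>
    at the re-entry point and \<open>cr'\<close> at the point hit on the opposite side.\<close>
  have cr: "2 * cvec_cross v (\<tau> (t n)) = a n - jump (w n) v" for n
    unfolding cvec_cross_frame[of _ _ "w n"] jump_def sgn frame(1) a_def by (simp add: field_simps)
  have cr': "2 * cvec_cross v (\<tau> (t n) + to_opposite (k n)) = a n + jump (w n) v" for n
    unfolding cvec_cross_frame[of _ _ "w n"] jump_def sgn frame(1) a_def side_linear
      to_opposite_frame[OF k(1), folded k(3)] by (simp add: field_simps)
  have "coding v w a"
    unfolding coding_def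
  proof (intro allI conjI)
    fix n
    have "side_cross (w n) v \<noteq> 0" using sgn[of n] by (auto simp: side_sign_def split: if_splits)
    then have "\<bar>side_cross (w n) v\<bar> * \<bar>side_dot (w n) (\<tau> (t n))\<bar> < \<bar>side_cross (w n) v\<bar> * (1 / 2)"
      using frame(2)[of n] by (intro mult_strict_left_mono) auto
    then show "\<bar>a n\<bar> < \<bar>side_cross (w n) v\<bar>" by (simp add: a_def abs_mult)
    have e: "\<tau> (t (n + 1)) + to_opposite (k (n + 1)) = \<tau> (t n) + of_real ((t (n + 1) - t n) * r) * v"
      by (rule step(1))
    have "cvec_cross v (\<tau> (t (n + 1)) + to_opposite (k (n + 1))) = cvec_cross v (\<tau> (t n))"
      unfolding e by (simp add: cvec_cross_def algebra_simps)
    then show "a (n + 1) = a n - jump (w n) v - jump (w (n + 1)) v"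
      using cr[of n] cr'[of "n + 1"] by simp
  qed
  then show ?thesis unfolding coded_def v_def by blast
qed

section \<open>Rotation by \<open>pi\<close> and the convention on directions\<close>

definition opposite_side :: "nat \<Rightarrow> nat" where
  "opposite_side k = (if k \<le> 4 then k + 4 else k - 4)"

lemma opposite_side:
  assumes "k \<in> {1..8}"
  shows "opposite_side k \<in> {1..8}" "side_label (opposite_side k) = side_label k"
    "oct_vertex (opposite_side k) = - oct_vertex k" "oct_vertex (opposite_side k + 1) = - oct_vertex (k + 1)"
    "to_opposite (opposite_side k) = - to_opposite k"
    "z \<in> oct_side k \<Longrightarrow> - z \<in> oct_side (opposite_side k)"
proof -
  show "opposite_side k \<in> {1..8}" using assms by (auto simp: opposite_side_def)
  show "side_label (opposite_side k) = side_label k"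
    by (rule side_index_cases[OF assms]) (simp_all add: opposite_side_def side_label_simps flip: One_nat_def)
  show v: "oct_vertex (opposite_side k) = - oct_vertex k"
    using oct_vertex_opposite[of k] oct_vertex_opposite[of "k - 4"] by (auto simp: opposite_side_def)
  show v': "oct_vertex (opposite_side k + 1) = - oct_vertex (k + 1)"
  proof (cases "k \<le> 4")
    case True
    then have "opposite_side k + 1 = k + 1 + 4" by (simp add: opposite_side_def)
    then show ?thesis by (simp only: oct_vertex_opposite)
  next
    case False
    then have "k + 1 = opposite_side k + 1 + 4" by (simp add: opposite_side_def)
    then show ?thesis by (metis oct_vertex_opposite minus_minus)
  qed
  show "to_opposite (opposite_side k) = - to_opposite k"
    unfolding to_opposite_eq v v' by simp
  assume "z \<in> oct_side k"
  then obtain u where u: "oct_vertex k \<noteq> oct_vertex (k + 1)" "0 < u" "u < 1"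
    "z = (1 - u) *\<^sub>R oct_vertex k + u *\<^sub>R oct_vertex (k + 1)"
    unfolding oct_side_def in_segment by blast
  moreover from u(4) have "- z = (1 - u) *\<^sub>R - oct_vertex k + u *\<^sub>R - oct_vertex (k + 1)" by simp
  ultimately show "- z \<in> oct_side (opposite_side k)"
    unfolding oct_side_def v v' in_segment by (metis neg_equal_iff_equal)
qed

lemma octagon_uminus: "uminus ` octagon = octagon"
proof -
  have "uminus ` oct_vertex ` {1..8} \<subseteq> oct_vertex ` {1..8}"
  proof clarify
    fix k :: nat assume "k \<in> {1..8}"
    from opposite_side(1,3)[OF this] show "- oct_vertex k \<in> oct_vertex ` {1..8}" by (metis imageI)
  qed
  then have "uminus ` octagon \<subseteq> octagon"
    unfolding octagon_def convex_hull_linear_image[OF linear_uminus] by (rule hull_mono)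
  moreover from this have "octagon \<subseteq> uminus ` octagon" by (metis image_subset_iff imageI minus_minus subsetI)
  ultimately show ?thesis by (rule subset_antisym)
qed

lemma interior_octagon_uminus: "z \<in> interior octagon \<Longrightarrow> - z \<in> interior octagon"
  using interior_negations[of octagon] unfolding octagon_uminus by (metis imageI)

text \<open>The half turn exchanges opposite sides and negates the translations between
  them.\<close>

lemma linear_trajectory_uminus:
  assumes "linear_trajectory \<theta> \<tau>" "cis \<phi> = - cis \<theta>"
  shows "linear_trajectory \<phi> (\<lambda>s. - \<tau> s)"
proof -
  obtain r where r: "r > 0" and tr: "\<And>s. (\<tau> s \<in> interior octagon \<and>
        (\<exists>\<epsilon>>0. \<forall>u. \<bar>u\<bar> < \<epsilon> \<longrightarrow> \<tau> (s + u) = \<tau> s + of_real (u * r) * cis \<theta>)) \<or>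
     (\<exists>k\<in>{1..8}. \<tau> s \<in> oct_side k \<and>
        (\<exists>\<epsilon>>0. (\<forall>u. 0 \<le> u \<and> u < \<epsilon> \<longrightarrow> \<tau> (s + u) = \<tau> s + of_real (u * r) * cis \<theta>) \<and>
               (\<forall>u. - \<epsilon> < u \<and> u < 0 \<longrightarrow>
                  \<tau> (s + u) = \<tau> s + to_opposite k + of_real (u * r) * cis \<theta>)))"
    using assms(1) unfolding linear_trajectory_def by blast
  show ?thesis
    unfolding linear_trajectory_def assms(2)
  proof (intro exI[of _ r] conjI allI)
    fix s
    from tr[of s] show "(- \<tau> s \<in> interior octagon \<and>
        (\<exists>\<epsilon>>0. \<forall>u. \<bar>u\<bar> < \<epsilon> \<longrightarrow> - \<tau> (s + u) = - \<tau> s + of_real (u * r) * - cis \<theta>)) \<or>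
     (\<exists>k\<in>{1..8}. - \<tau> s \<in> oct_side k \<and>
        (\<exists>\<epsilon>>0. (\<forall>u. 0 \<le> u \<and> u < \<epsilon> \<longrightarrow> - \<tau> (s + u) = - \<tau> s + of_real (u * r) * - cis \<theta>) \<and>
               (\<forall>u. - \<epsilon> < u \<and> u < 0 \<longrightarrow>
                  - \<tau> (s + u) = - \<tau> s + to_opposite k + of_real (u * r) * - cis \<theta>)))"
    proof (elim disjE conjE bexE exE, goal_cases)
      case (1 \<epsilon>)
      then show ?case by (intro disjI1 conjI interior_octagon_uminus exI[of _ \<epsilon>]) auto
    next
      case (2 k \<epsilon>)
      then show ?case
        by (intro disjI2 bexI[of _ "opposite_side k"] conjI exI[of _ \<epsilon>]) (auto simp: opposite_side simp del: atLeastAtMost_iff)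
    qed
  qed (rule r)
qed

lemma cutting_sequence_uminus:
  assumes "cutting_sequence \<tau> w" shows "cutting_sequence (\<lambda>s. - \<tau> s) w"
proof -
  have "(\<exists>k\<in>{1..8}. - z \<in> oct_side k \<and> P (side_label k)) \<longleftrightarrow> (\<exists>k\<in>{1..8}. z \<in> oct_side k \<and> P (side_label k))" for z P
    using opposite_side(1,2,6) by (metis minus_minus)
  from this[of _ "\<lambda>_. True"] this[of _ "\<lambda>X. X = _"] show ?thesis
    using assms unfolding cutting_sequence_def by (simp add: eq_commute[of "w _"])
qed

lemma direction_upper_half:
  obtains \<phi> where "\<phi> \<in> {0..pi}" "cis \<phi> = cis \<theta> \<or> cis \<phi> = - cis \<theta>"
proof -
  define \<alpha> where "\<alpha> = Arg (cis \<theta>)"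
  have a: "cis \<alpha> = cis \<theta>" by (simp add: \<alpha>_def cis_Arg sgn_div_norm)
  have b: "- pi < \<alpha>" "\<alpha> \<le> pi" using Arg_bounded[of "cis \<theta>"] by (auto simp: \<alpha>_def)
  show ?thesis
  proof (cases "\<alpha> \<ge> 0")
    case True
    then show ?thesis using that[of \<alpha>] a b by simp
  next
    case False
    have "cis (\<alpha> + pi) = - cis \<theta>" unfolding cis_mult[symmetric] a by simp
    then show ?thesis using that[of "\<alpha> + pi"] b False by simp
  qed
qed

section \<open>Reading off the expansion\<close>

text \<open>On a common boundary the floor selects the upper sector, so \<open>pi / 8\<close> gets
  index 1; only \<open>pi\<close> has to be sent down to sector 7.\<close>

lemma ex_sector:
  assumes "\<theta> \<in> {0..pi}"
  obtains i where "i \<le> 7" "\<theta> \<in> sector i" "pi / 8 \<le> \<theta> \<Longrightarrow> 1 \<le> i"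
proof (cases "\<theta> = pi")
  case True
  then show ?thesis using that[of 7] by (simp add: sector_def)
next
  case False
  define i where "i = nat \<lfloor>8 * \<theta> / pi\<rfloor>"
  have nn: "0 \<le> 8 * \<theta> / pi" using assms by simp
  have i: "real i \<le> 8 * \<theta> / pi" "8 * \<theta> / pi < real i + 1"
    using nn by (simp_all add: i_def of_nat_nat)
  have s: "\<theta> \<in> sector i" using i by (simp add: sector_def field_simps)
  have "8 * \<theta> / pi < 8" using assms False by (simp add: divide_less_eq)
  then have "i \<le> 7" using i(1) by simp
  moreover have "1 \<le> i" if "pi / 8 \<le> \<theta>"
    using that i(2) by (simp add: i_def le_nat_floor field_simps)
  ultimately show ?thesis using that s by blast
qed

text \<open>Induction along the Farey iteration: the iterated direction codes the renormalised word,
  which stays non-periodic. After the first step the angle is at least \<open>pi / 8\<close>, so the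
  later entries are at least 1 as \<open>S_star\<close> demands.\<close>

lemma octagon_cf_diagram_seq:
  assumes p: "\<phi> \<in> {0..pi}" and c: "coded (cis \<phi>) w" and np: "\<not> periodic_word w"
  shows "octagon_cf \<phi> (diagram_seq w)"
proof -
  define s where "s = diagram_seq w"
  have step: "\<exists>i\<le>7. s k = i \<and> cf_iter s \<phi> k \<in> sector i \<and> (k > 0 \<longrightarrow> 1 \<le> i)"
    if k: "cf_iter s \<phi> k \<in> {0..pi}" "k > 0 \<longrightarrow> pi / 8 \<le> cf_iter s \<phi> k"
      "coded (cis (cf_iter s \<phi> k)) (renorm_word w k)" "\<not> periodic_word (renorm_word w k)" for k
  proof -
    obtain i where i: "i \<le> 7" "cf_iter s \<phi> k \<in> sector i" "pi / 8 \<le> cf_iter s \<phi> k \<Longrightarrow> 1 \<le> i"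
      using ex_sector[OF k(1)] by blast
    have "s k = i" unfolding s_def diagram_seq_def by (rule diagram_of_sector[OF i(1,2) k(3,4)])
    then show ?thesis using i k(2) by blast
  qed
  have inv: "cf_iter s \<phi> k \<in> {0..pi} \<and> (k > 0 \<longrightarrow> pi / 8 \<le> cf_iter s \<phi> k) \<and>
      coded (cis (cf_iter s \<phi> k)) (renorm_word w k) \<and> \<not> periodic_word (renorm_word w k)" for k
  proof (induction k)
    case 0
    then show ?case using p c np by simp
  next
    case (Suc k)
    then obtain i where i: "i \<le> 7" "s k = i" "cf_iter s \<phi> k \<in> sector i" using step by blast
    have d: "diagram_of (renorm_word w k) = i" using i(2) by (simp add: s_def diagram_seq_def)
    have "pi / 8 \<le> farey i (cf_iter s \<phi> k)" "farey i (cf_iter s \<phi> k) \<le> pi" using farey_spec[OF i(3)] by blast+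
    moreover have "0 \<le> pi / 8" by simp
    ultimately show ?case
      using coded_farey[OF i(1,3)] nonperiodic_farey[OF i(1,3)] Suc
      by (simp add: i(2) d)
  qed
  then have st: "s k \<le> 7 \<and> cf_iter s \<phi> k \<in> sector (s k) \<and> (k > 0 \<longrightarrow> 1 \<le> s k)" for k using step[of k] by blast
  have "s \<in> S_star" using st by (auto simp: S_star_def Suc_le_eq)
  then show ?thesis using st inv unfolding s_def[symmetric] by (intro octagon_cf_if_iter) blast+
qed

theorem theorem2p3p1:
  fixes w :: word
  assumes cutting: "\<exists>\<theta> \<tau>. linear_trajectory \<theta> \<tau> \<and> cutting_sequence \<tau> w"
    and nonperiodic: "\<not> periodic_word w"
  shows "\<exists>\<theta>\<in>{0..pi}.
    (\<forall>\<phi>\<in>{0..pi}. (\<exists>\<tau>. linear_trajectory \<phi> \<tau> \<and> cutting_sequence \<tau> w) \<longleftrightarrow> \<phi> = \<theta>) \<and>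
    octagon_cf \<theta> (diagram_seq w)"
proof -
  obtain \<theta>0 \<tau>0 where 0: "linear_trajectory \<theta>0 \<tau>0" "cutting_sequence \<tau>0 w" using cutting by blast
  obtain \<theta> where \<theta>: "\<theta> \<in> {0..pi}" "cis \<theta> = cis \<theta>0 \<or> cis \<theta> = - cis \<theta>0"
    by (rule direction_upper_half)
  have ex: "\<exists>\<tau>. linear_trajectory \<theta> \<tau> \<and> cutting_sequence \<tau> w"
  proof (cases "cis \<theta> = cis \<theta>0")
    case True
    then show ?thesis using 0 unfolding linear_trajectory_def by metis
  next
    case False
    then show ?thesis using linear_trajectory_uminus[OF 0(1)] cutting_sequence_uminus[OF 0(2)] \<theta>(2) by blast
  qed
  have cf: "octagon_cf \<phi> (diagram_seq w)"
    if "\<phi> \<in> {0..pi}" "\<exists>\<tau>. linear_trajectory \<phi> \<tau> \<and> cutting_sequence \<tau> w" for \<phi>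
    using octagon_cf_diagram_seq[OF that(1) _ nonperiodic] coded_trajectory that(2) by blast
  \<comment> \<open>All these directions have the expansion \<open>diagram_seq w\<close>, whose
    cells meet in a single point.\<close>
  have "\<phi> = \<theta>" if "\<phi> \<in> {0..pi}" "\<exists>\<tau>. linear_trajectory \<phi> \<tau> \<and> cutting_sequence \<tau> w" for \<phi>
    using cf[OF that] cf[OF \<theta>(1) ex] unfolding octagon_cf_def by (metis singleton_inject)
  then show ?thesis using \<theta>(1) ex cf[OF \<theta>(1) ex] by blast
qed

end
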